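(* Let $M$ and $N$ be bipersistence modules over a finite field $\mathbb{K}$ with finite presentations $P^M$ and $P^N$, and let $\mathcal{A}$ be the associated line arrangement in $\Omega$. For any face $f$ of $\mathcal{A}$, there is some choice of $p,q\in\mathrm{gr}(P^M)\cup\mathrm{gr}(P^N)$ such that $$d_B(M^\ell,N^\ell)=c_{pq}\,\delta_{p,q}(\ell)\qquad\text{for all }\ell\in\alpha(f).$$
   Context: Let $\mathbb{K}$ be a fixed finite field. For $d\in\{1,2\}$, equip $\mathbb{R}^d$ with the product order. A persistence module ($d=1$), resp. bipersistence module ($d=2$), is a functor from the poset $\mathbb{R}^d$ to $\mathbb{K}$-vector spaces. Finite presentation: a $k\times m$ matrix $P$ over $\mathbb{K}$ whose rows and columns are each labeled by a grade $\mathrm{gr}(-)\in\mathbb{R}^d$ such that $P_{ij}\ne0$ implies $\mathrm{gr}(\mathrm{row}_i)\le \mathrm{gr}(\mathrm{col}_j)$. It defines a module $M^P$ by $M^P_x=\mathrm{span}\{e_i\mid \mathrm{gr}(\mathrm{row}_i)\le x\}/\mathrm{span}\{\mathrm{col}_j\mid \mathrm{gr}(\mathrm{col}_j)\le x\}$, where $e_1,\dots,e_k$ is the standard basis of $\mathbb{K}^k$, with maps induced by inclusions. $P$ is a presentation of $N$ if $N\cong M^P$. $\mathrm{gr}(P)$ is the multiset of grades of all rows and columns of $P$. Persistence diagram: for a finitely presented persistence module $M$ over $\mathbb{R}$, $D(M)$ is the finite multiset of pairs $(b,d)\in\mathbb{R}\times(\mathbb{R}\cup\{\infty\})$, $b<d$,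 such that $M$ is isomorphic to the direct sum of the interval modules supported on $[b,d)$. Bottleneck distance: a matching between diagrams $D_1,D_2$ is a bijection $\sigma:D_1'\to D_2'$ with $D_i'\subseteq D_i$. Its cost is $\max(A,B)$ with $A=\max\{\max(|a-c|,|b-d|)\mid (a,b)\in D_1',\ \sigma(a,b)=(c,d)\}$ and $B=\max\{(b-a)/2\mid (a,b)\in(D_1\setminus D_1')\cup(D_2\setminus D_2')\}$, where $\infty-\infty=0$ (and the maximum of the empty set is $0$). $d_B(D_1,D_2)$ is the minimal cost of a matching, and $d_B(M,N):=d_B(D(M),D(N))$. Slices: a slice is a line $\ell: y=sx+t$ with $s>0$, $t\in\mathbb{R}$, parameterized isometrically and order-preservingly by $\lambda(x)=\left(\frac{x}{\sqrt{1+s^2}},\frac{sx}{\sqrt{1+s^2}}+t\right)$. The slice module $M^\ell$ is $M^\ell_x:=M_{\lambda(x)}$ with the induced maps. Let $\Omega=(0,\infty)\times\mathbb{R}$, and let $\alpha$ be the bijection sending $(s,t)\in\Omega$ to the slice $y=sx+t$. Line arrangements: a finite set of lines induces a subdivision of $\Omega$; its faces are the connected components of $\Omega$ minus the union of the lines. Arrangement $\mathcal{A}_0$: for $v\in\mathbb{R}^2$ let $L_v$ be the line $t=-v_x s+v_y$ in the $(s,t)$-plane. $\mathcal{A}_0$ is the arrangement in $\Omega$ induced by the lines $L_v$, $v\in\mathrm{gr}(P^M)\cup\mathrm{gr}(P^N)$. Pushes: for $p\in\mathbb{R}^2$ and a slice $\ell:y=sx+t$, $\mathrm{push}(p,\ell)=(p_x,sp_x+t)$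 if $p$ lies below $\ell$ and $\mathrm{push}(p,\ell)=(\frac{p_y-t}{s},p_y)$ if $p$ lies on or above $\ell$. Set $\delta_{p,q}(\ell)=\delta_{p,q}(s,t)=\|\mathrm{push}(p,\ell)-\mathrm{push}(q,\ell)\|_2$. Types: on each face of $\mathcal{A}_0$, for given grades $p,q$, exactly one of these holds for all slices of the face: (I) the slice is below both $p$ and $q$; (II) it is above both; (IIIa) $p$ is above and $q$ below the slice; (IIIb) $p$ is below and $q$ above the slice. Correspondingly $\delta_{p,q}(s,t)=|g_{p,q}(s,t)|\sqrt{1+1/s^2}$ on the face, with $g_{p,q}$ equal to $p_y-q_y$ (I), $s(p_x-q_x)$ (II), $p_y-t-sq_x$ (IIIa), $q_y-t-sp_x$ (IIIb). Constants: $c_{pq}=\frac12$ if $p,q\in\mathrm{gr}(P^M)$ or $p,q\in\mathrm{gr}(P^N)$, and $c_{pq}=1$ otherwise; here the union of the two grade sets is understood as a disjoint union, so that each grade remembers which presentation it comes from. Arrangement $\mathcal{A}$: the arrangement in $\Omega$ formed by all lines of $\mathcal{A}_0$, the vertical line $s=1$, and all lines arising as solutions, within faces of $\mathcal{A}_0$, of the equations $\delta_{p,q}=0$ (for $p,q\in\mathrm{gr}(P^M)$ or $p,q\in\mathrm{gr}(P^N)$) and $c_{pq}\delta_{p,q}=c_{p'q'}\delta_{p',q'}$ (for $p,q,p',q'\in\mathrm{gr}(P^M)\sqcup\mathrm{gr}(P^N)$). Explicitly, for every face of $\mathcal{A}_0$, with $g$ given by the types on that face, these are the zero set of $g_{p,q}$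 and the zero sets of $c_{pq}g_{p,q}-c_{p'q'}g_{p',q'}$ and $c_{pq}g_{p,q}+c_{p'q'}g_{p',q'}$, respectively, each included whenever it is a line meeting $\Omega$.
   Formalization: The formal theorem additionally assumes that gr(P^M) ∪ gr(P^N) is non-empty and that d_B(M^ℓ,N^ℓ) is finite for at least one slice of the face; without these the claim fails (no p,q to choose, or d_B = ∞ when the numbers of infinite bars differ). *)

theory Defs
  imports
    "HOL-Analysis.Analysis"
    "HOL-Library.Product_Order"
    "HOL-Algebra.AbelCoset"
    "Jordan_Normal_Form.VS_Connect"
begin

text \<open>
  Vector spaces are carrier-based: \<open>vectorspace class_ring V\<close> says that the record \<open>V\<close> is
  a vector space over the field given by the type \<open>'k\<close>. The fields \<open>mult\<close> and \<open>one\<close>, which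
  the record type inherits from rings, carry no information and are left undefined.
\<close>

section \<open>Persistence modules\<close>

record ('g, 'k, 'v) pers_module =
  pspace :: "'g \<Rightarrow> ('k, 'v) module"
  pmap :: "'g \<Rightarrow> 'g \<Rightarrow> 'v \<Rightarrow> 'v"

definition persistence_module :: "('g::order, 'k::field, 'v) pers_module \<Rightarrow> bool" where
  "persistence_module M \<longleftrightarrow>
     (\<forall>x. vectorspace class_ring (pspace M x)) \<and>
     (\<forall>x y. x \<le> y \<longrightarrow> linear_map class_ring (pspace M x) (pspace M y) (pmap M x y)) \<and>
     (\<forall>x. \<forall>v\<in>carrier (pspace M x). pmap M x x v = v) \<and>
     (\<forall>x y z. x \<le> y \<longrightarrow> y \<le> z \<longrightarrow>
        (\<forall>v\<in>carrier (pspace M x). pmap M y z (pmap M x y v) = pmap M x z v))"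

definition pm_iso ::
  "('g::order, 'k::field, 'v) pers_module \<Rightarrow> ('g, 'k, 'w) pers_module \<Rightarrow> bool" where
  "pm_iso M N \<longleftrightarrow>
     (\<exists>h. (\<forall>x. linear_map class_ring (pspace M x) (pspace N x) (h x) \<and>
               bij_betw (h x) (carrier (pspace M x)) (carrier (pspace N x))) \<and>
          (\<forall>x y. x \<le> y \<longrightarrow>
             (\<forall>v\<in>carrier (pspace M x). h y (pmap M x y v) = pmap N x y (h x v))))"


section \<open>Finite presentations\<close>

record ('g, 'k) presentation =
  pres_mat :: "'k mat"
  row_grades :: "'g list"
  col_grades :: "'g list"

definition valid_presentation :: "('g::order, 'k::field) presentation \<Rightarrow> bool" where
  "valid_presentation P \<longleftrightarrow>
     length (row_grades P) = dim_row (pres_mat P) \<and>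
     length (col_grades P) = dim_col (pres_mat P) \<and>
     (\<forall>i<dim_row (pres_mat P). \<forall>j<dim_col (pres_mat P).
        pres_mat P $$ (i, j) \<noteq> 0 \<longrightarrow> row_grades P ! i \<le> col_grades P ! j)"

definition gr :: "('g, 'k) presentation \<Rightarrow> 'g multiset" where
  "gr P = mset (row_grades P) + mset (col_grades P)"

definition ambient_space :: "('g, 'k::field) presentation \<Rightarrow> ('k, 'k Matrix.vec) module" where
  "ambient_space P = module_vec TYPE('k) (dim_row (pres_mat P))"

definition generator_span :: "('g::order, 'k::field) presentation \<Rightarrow> 'g \<Rightarrow> 'k Matrix.vec set" where
  "generator_span P x = LinearCombinations.module.span class_ring (ambient_space P)
     {unit_vec (dim_row (pres_mat P)) i | i. i < dim_row (pres_mat P) \<and> row_grades P ! i \<le> x}"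

definition relation_span :: "('g::order, 'k::field) presentation \<Rightarrow> 'g \<Rightarrow> 'k Matrix.vec set" where
  "relation_span P x = LinearCombinations.module.span class_ring (ambient_space P)
     {col (pres_mat P) j | j. j < dim_col (pres_mat P) \<and> col_grades P ! j \<le> x}"

text \<open>The quotient \<open>U / W\<close> for subspaces \<open>W \<subseteq> U\<close> of \<open>V\<close>; its elements are cosets of \<open>W\<close>.\<close>

definition quotient_space ::
  "('k, 'v) module \<Rightarrow> 'v set \<Rightarrow> 'v set \<Rightarrow> ('k, 'v set) module" where
  "quotient_space V U W =
     \<lparr>carrier = {W +>\<^bsub>V\<^esub> u | u. u \<in> U}, mult = undefined, one = undefined,
      zero = W, add = set_add V,
      smult = (\<lambda>c A. \<Union>a\<in>A. W +>\<^bsub>V\<^esub> (c \<odot>\<^bsub>V\<^esub> a))\<rparr>"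

text \<open>
  The map induced by the inclusion sends the coset of \<open>v\<close> at \<open>x\<close> to the coset of \<open>v\<close> at \<open>y\<close>;
  the union below is over all representatives, which yield the same coset if \<open>x \<le> y\<close>.
\<close>

definition presented_module ::
  "('g::order, 'k::field) presentation \<Rightarrow> ('g, 'k, 'k Matrix.vec set) pers_module" where
  "presented_module P =
     \<lparr>pspace = (\<lambda>x. quotient_space (ambient_space P) (generator_span P x) (relation_span P x)),
      pmap = (\<lambda>x y A. \<Union>a\<in>A. relation_span P y +>\<^bsub>ambient_space P\<^esub> a)\<rparr>"

definition is_presentation_of ::
  "('g::order, 'k::field) presentation \<Rightarrow> ('g, 'k, 'v) pers_module \<Rightarrow> bool" where
  "is_presentation_of P M \<longleftrightarrow> valid_presentation P \<and> pm_iso M (presented_module P)"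


section \<open>Persistence diagrams\<close>

definition interval_module :: "real \<times> ereal \<Rightarrow> (real, 'k::field, 'k) pers_module" where
  "interval_module = (\<lambda>(b, d).
     \<lparr>pspace = (\<lambda>x.
        \<lparr>carrier = (if b \<le> x \<and> ereal x < d then UNIV else {0}),
         mult = undefined, one = undefined, zero = 0, add = (+), smult = (*)\<rparr>),
      pmap = (\<lambda>x y c. if ereal y < d then c else 0)\<rparr>)"

text \<open>Direct sum over a finite index set \<open>I\<close>, where it agrees with the product.\<close>

definition pm_direct_sum ::
  "'i set \<Rightarrow> ('i \<Rightarrow> ('g, 'k, 'v) pers_module) \<Rightarrow> ('g, 'k, 'i \<Rightarrow> 'v) pers_module" where
  "pm_direct_sum I F =
     \<lparr>pspace = (\<lambda>x.
        \<lparr>carrier = (\<Pi>\<^sub>E i\<in>I. carrier (pspace (F i) x)),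
         mult = undefined, one = undefined,
         zero = (\<lambda>i\<in>I. \<zero>\<^bsub>pspace (F i) x\<^esub>),
         add = (\<lambda>v w. \<lambda>i\<in>I. v i \<oplus>\<^bsub>pspace (F i) x\<^esub> w i),
         smult = (\<lambda>c v. \<lambda>i\<in>I. c \<odot>\<^bsub>pspace (F i) x\<^esub> v i)\<rparr>),
      pmap = (\<lambda>x y v. \<lambda>i\<in>I. pmap (F i) x y (v i))\<rparr>"

definition is_persistence_diagram ::
  "(real, 'k::field, 'v) pers_module \<Rightarrow> (real \<times> ereal) multiset \<Rightarrow> bool" where
  "is_persistence_diagram M D \<longleftrightarrow>
     (\<forall>(b, d)\<in>#D. ereal b < d) \<and>
     (\<exists>xs. mset xs = D \<and>
        pm_iso M (pm_direct_sum {..<length xs} (\<lambda>i. interval_module (xs ! i))))"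

definition persistence_diagram ::
  "(real, 'k::field, 'v) pers_module \<Rightarrow> (real \<times> ereal) multiset" where
  "persistence_diagram M = (THE D. is_persistence_diagram M D)"


section \<open>Bottleneck distance\<close>

text \<open>A matching is given by the multiset of its matched pairs.\<close>

definition matchings ::
  "(real \<times> ereal) multiset \<Rightarrow> (real \<times> ereal) multiset \<Rightarrow>
   ((real \<times> ereal) \<times> (real \<times> ereal)) multiset set" where
  "matchings D1 D2 = {S. image_mset fst S \<subseteq># D1 \<and> image_mset snd S \<subseteq># D2}"

text \<open>The case distinction implements \<open>\<infinity> - \<infinity> = 0\<close>, which fails in type \<^typ>\<open>ereal\<close>.\<close>

definition pair_cost :: "real \<times> ereal \<Rightarrow> real \<times> ereal \<Rightarrow> ereal" where
  "pair_cost = (\<lambda>(a, b) (c, d). max (ereal \<bar>a - c\<bar>) (if b = d then 0 else \<bar>b - d\<bar>))"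

definition matching_cost ::
  "(real \<times> ereal) multiset \<Rightarrow> (real \<times> ereal) multiset \<Rightarrow>
   ((real \<times> ereal) \<times> (real \<times> ereal)) multiset \<Rightarrow> ereal" where
  "matching_cost D1 D2 S =
     Max (insert 0
       ({pair_cost u v | u v. (u, v) \<in># S} \<union>
        {(b - ereal a) / 2 | a b.
           (a, b) \<in># (D1 - image_mset fst S) + (D2 - image_mset snd S)}))"

text \<open>There are only finitely many matchings, so the infimum is a minimum.\<close>

definition diagram_bottleneck ::
  "(real \<times> ereal) multiset \<Rightarrow> (real \<times> ereal) multiset \<Rightarrow> ereal" where
  "diagram_bottleneck D1 D2 = (INF S\<in>matchings D1 D2. matching_cost D1 D2 S)"

definition bottleneck_dist ::
  "(real, 'k::field, 'v) pers_module \<Rightarrow> (real, 'k, 'w) pers_module \<Rightarrow> ereal" where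
  "bottleneck_dist M N = diagram_bottleneck (persistence_diagram M) (persistence_diagram N)"


section \<open>Slices\<close>

text \<open>A slice \<open>y = s x + t\<close> is represented by its parameter pair \<open>(s, t) \<in> \<Omega>\<close>.\<close>

definition slice_params :: "(real \<times> real) set" where
  "slice_params = {0<..} \<times> UNIV"

definition slice_point :: "real \<times> real \<Rightarrow> real \<Rightarrow> real \<times> real" where
  "slice_point = (\<lambda>(s, t) x. (x / sqrt (1 + s\<^sup>2), s * x / sqrt (1 + s\<^sup>2) + t))"

definition slice_module ::
  "(real \<times> real, 'k, 'v) pers_module \<Rightarrow> real \<times> real \<Rightarrow> (real, 'k, 'v) pers_module" where
  "slice_module M l =
     \<lparr>pspace = (\<lambda>x. pspace M (slice_point l x)),
      pmap = (\<lambda>x y. pmap M (slice_point l x) (slice_point l y))\<rparr>"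

definition below_slice :: "real \<times> real \<Rightarrow> real \<times> real \<Rightarrow> bool" where
  "below_slice p = (\<lambda>(s, t). snd p < s * fst p + t)"

definition above_slice :: "real \<times> real \<Rightarrow> real \<times> real \<Rightarrow> bool" where
  "above_slice p = (\<lambda>(s, t). s * fst p + t < snd p)"

definition push :: "real \<times> real \<Rightarrow> real \<times> real \<Rightarrow> real \<times> real" where
  "push p = (\<lambda>(s, t).
     if below_slice p (s, t) then (fst p, s * fst p + t) else ((snd p - t) / s, snd p))"

definition push_dist :: "real \<times> real \<Rightarrow> real \<times> real \<Rightarrow> real \<times> real \<Rightarrow> real" where
  "push_dist p q l = norm (push p l - push q l)"


section \<open>Line arrangements\<close>

definition faces :: "(real \<times> real) set set \<Rightarrow> (real \<times> real) set set" where
  "faces \<L> = components (slice_params - \<Union>\<L>)"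

definition is_line :: "(real \<times> real) set \<Rightarrow> bool" where
  "is_line L \<longleftrightarrow> affine L \<and> aff_dim L = 1"

definition dual_line :: "real \<times> real \<Rightarrow> (real \<times> real) set" where
  "dual_line v = {(s, t). t = - fst v * s + snd v}"

definition base_lines ::
  "(real \<times> real, 'k) presentation \<Rightarrow> (real \<times> real, 'k) presentation \<Rightarrow>
   (real \<times> real) set set" where
  "base_lines PM PN = dual_line ` (set_mset (gr PM) \<union> set_mset (gr PN))"

text \<open>
  Grades tagged with their origin: \<open>Inl\<close> for the first and \<open>Inr\<close> for the second presentation.
\<close>

type_synonym tagged_grade = "real \<times> real + real \<times> real"

definition tagged_grades ::
  "(real \<times> real, 'k) presentation \<Rightarrow> (real \<times> real, 'k) presentation \<Rightarrow> tagged_grade set" where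
  "tagged_grades PM PN = Sum_Type.Plus (set_mset (gr PM)) (set_mset (gr PN))"

definition untag :: "tagged_grade \<Rightarrow> real \<times> real" where
  "untag = case_sum id id"

definition same_origin :: "tagged_grade \<Rightarrow> tagged_grade \<Rightarrow> bool" where
  "same_origin p q \<longleftrightarrow> (isl p \<longleftrightarrow> isl q)"

definition cost_weight :: "tagged_grade \<Rightarrow> tagged_grade \<Rightarrow> real" where
  "cost_weight p q = (if same_origin p q then 1 / 2 else 1)"

text \<open>
  On a face \<open>f\<close> of the arrangement of the base lines exactly one of the four types applies to
  each pair of grades, so the last branch below is the one with \<open>p\<close> below and \<open>q\<close> above all
  slices of \<open>f\<close>. The result is used as a function on the whole plane.
\<close>

definition face_fun ::
  "(real \<times> real) set \<Rightarrow> real \<times> real \<Rightarrow> real \<times> real \<Rightarrow> real \<times> real \<Rightarrow> real" where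
  "face_fun f p q = (\<lambda>(s, t).
     if \<forall>l\<in>f. above_slice p l \<and> above_slice q l then snd p - snd q
     else if \<forall>l\<in>f. below_slice p l \<and> below_slice q l then s * (fst p - fst q)
     else if \<forall>l\<in>f. above_slice p l \<and> below_slice q l then snd p - t - s * fst q
     else snd q - t - s * fst p)"

definition equation_sets ::
  "(real \<times> real, 'k) presentation \<Rightarrow> (real \<times> real, 'k) presentation \<Rightarrow>
   (real \<times> real) set set" where
  "equation_sets PM PN =
     {{l. face_fun f (untag p) (untag q) l = 0} | f p q.
        f \<in> faces (base_lines PM PN) \<and>
        p \<in> tagged_grades PM PN \<and> q \<in> tagged_grades PM PN \<and> same_origin p q} \<union>
     {{l. cost_weight p q * face_fun f (untag p) (untag q) l
          + e * (cost_weight p' q' * face_fun f (untag p') (untag q') l) = 0} | f p q p' q' e.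
        f \<in> faces (base_lines PM PN) \<and> e \<in> {-1, 1} \<and>
        p \<in> tagged_grades PM PN \<and> q \<in> tagged_grades PM PN \<and>
        p' \<in> tagged_grades PM PN \<and> q' \<in> tagged_grades PM PN}"

definition arrangement ::
  "(real \<times> real, 'k) presentation \<Rightarrow> (real \<times> real, 'k) presentation \<Rightarrow>
   (real \<times> real) set set" where
  "arrangement PM PN =
     base_lines PM PN \<union> {{(s, t). s = 1}} \<union>
     {L \<in> equation_sets PM PN. is_line L \<and> L \<inter> slice_params \<noteq> {}}"

end

theory Submission
  imports Defs
begin

text \<open>
  On a fixed slice, a grade enters the module at the time at which the slice passes its push, and the
  distance between two pushes is the difference of these times. The slice modules of \<open>M\<close> therefore
  all arise from the same matrix, with only the real grades of its rows and columns changing. A face of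
  the arrangement is chosen so that nothing combinatorial changes on it: the left-hand sides of the
  equations are affine functions, and each of them has constant sign on the face. Hence the
  times of the grades of one presentation are ordered in the same way for all slices of the face, and so
  are all the numbers \<open>c\<^sub>p\<^sub>q \<delta>\<^sub>p\<^sub>q\<close> (\<open>slice_time_order_constant\<close>, \<open>cost_order_constant\<close>).

  The persistence diagram of a slice depends on the order of the grades only. At time \<open>x\<close> the module
  is \<open>U\<^sub>x / W\<^sub>x\<close>, where \<open>U\<close> is the filtration by generators and \<open>W\<close> the filtration by relations, and two
  filtrations of a finite-dimensional space always have a common adapted basis
  (\<open>common_adapted_coords\<close>). Each vector of that basis has a row grade at which it enters \<open>U\<close>
  and possibly a column grade at which it enters \<open>W\<close>; these are the ends of a bar. Since the two filtrations
  as chains of subspaces depend on the orders of the row and column grades only, one basis serves all slices of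
  the face, so that the bars are given by fixed pairs of grades (\<open>slice_diagrams\<close>). That this
  decomposition yields the persistence diagram requires the uniqueness of interval decompositions; over a
  finite field it follows by counting the elements of the images of the structure maps, which determines
  how many bars contain a given interval (\<open>persistence_diagram_eqI\<close>).

  The costs of all pairs and unmatched bars are thus infinite or of the form \<open>c\<^sub>p\<^sub>q \<delta>\<^sub>p\<^sub>q\<close>, and so is the bottleneck
  distance, being attained (\<open>diagram_bottleneck_value\<close>). A matching at one slice of the
  face can be carried over to any other one, and it stays below a bound \<open>c\<^sub>p\<^sub>q \<delta>\<^sub>p\<^sub>q\<close> if it was below it before
  (\<open>diagram_bottleneck_transfer\<close>). If the bottleneck distance is finite at one slice and equal to \<open>c\<^sub>p\<^sub>q \<delta>\<^sub>p\<^sub>q\<close> there, carrying optimal matchings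
  in both directions shows that it equals \<open>c\<^sub>p\<^sub>q \<delta>\<^sub>p\<^sub>q\<close> on the whole face.
\<close>

section \<open>Coordinates adapted to two filtrations\<close>

text \<open>
  Vectors of \<open>K\<^sup>n\<close> are represented as functions on all natural numbers that vanish from \<open>n\<close> on. The
  span is that of a list, because relations are added one at a time, in the order of their grades.
\<close>

definition comb_span :: "(nat \<Rightarrow> 'k::field) list \<Rightarrow> (nat \<Rightarrow> 'k) set" where
  "comb_span ws = {v. \<exists>a. \<forall>i. v i = (\<Sum>j<length ws. a j * (ws ! j) i)}"

lemma comb_span_Nil: "v \<in> comb_span [] \<longleftrightarrow> (\<forall>i. v i = 0)"
  by (simp add: comb_span_def)

lemma comb_span_snoc:
  "v \<in> comb_span (ws @ [w]) \<longleftrightarrow> (\<exists>c. (\<lambda>i. v i - c * w i) \<in> comb_span ws)"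
proof
  assume "v \<in> comb_span (ws @ [w])"
  then obtain a where "\<And>i. v i = (\<Sum>j<Suc (length ws). a j * ((ws @ [w]) ! j) i)"
    by (auto simp: comb_span_def)
  then have "\<forall>i. v i - a (length ws) * w i = (\<Sum>j<length ws. a j * (ws ! j) i)"
    by (simp add: nth_append)
  then show "\<exists>c. (\<lambda>i. v i - c * w i) \<in> comb_span ws"
    unfolding comb_span_def by blast
next
  assume "\<exists>c. (\<lambda>i. v i - c * w i) \<in> comb_span ws"
  then obtain c a where *: "\<And>i. v i - c * w i = (\<Sum>j<length ws. a j * (ws ! j) i)"
    by (auto simp: comb_span_def)
  have "v i = (\<Sum>j<length (ws @ [w]). (a(length ws := c)) j * ((ws @ [w]) ! j) i)" for i
    using *[of i] by (simp add: nth_append algebra_simps)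
  then show "v \<in> comb_span (ws @ [w])"
    unfolding comb_span_def by blast
qed

definition linear_coords :: "((nat \<Rightarrow> 'k::field) \<Rightarrow> nat \<Rightarrow> 'k) \<Rightarrow> bool" where
  "linear_coords \<Phi> \<longleftrightarrow> bij \<Phi> \<and> (\<forall>v w i. \<Phi> (\<lambda>j. v j + w j) i = \<Phi> v i + \<Phi> w i) \<and>
     (\<forall>c v i. \<Phi> (\<lambda>j. c * v j) i = c * \<Phi> v i)"

lemma linear_coords_comp: "linear_coords \<Phi> \<Longrightarrow> linear_coords \<Psi> \<Longrightarrow> linear_coords (\<Psi> \<circ> \<Phi>)"
proof -
  assume a: "linear_coords \<Phi>" "linear_coords \<Psi>"
  then have "\<Phi> (\<lambda>j. v j + w j) = (\<lambda>j. \<Phi> v j + \<Phi> w j)" "\<Phi> (\<lambda>j. c * v j) = (\<lambda>j. c * \<Phi> v j)" for v w c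
    by (auto simp: linear_coords_def)
  moreover have "bij (\<Psi> \<circ> \<Phi>)"
    using a by (simp add: linear_coords_def bij_comp)
  ultimately show ?thesis using a(2) by (simp add: linear_coords_def)
qed

text \<open>
  The change of coordinates that replaces the basis vector \<open>b\<^sub>i\<close> by \<open>\<Sum> a\<^sub>k b\<^sub>k\<close>, the sum being over \<open>k \<in> J\<close>, where \<open>i \<in> J\<close>.
\<close>

definition pivot_coords :: "nat set \<Rightarrow> nat \<Rightarrow> (nat \<Rightarrow> 'k::field) \<Rightarrow> (nat \<Rightarrow> 'k) \<Rightarrow> nat \<Rightarrow> 'k" where
  "pivot_coords J i a v =
     (\<lambda>k. if k = i then v i / a i else if k \<in> J then v k - v i / a i * a k else v k)"

lemma linear_coords_pivot:
  assumes "a i \<noteq> 0"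
  shows "linear_coords (pivot_coords J i a)"
proof -
  have "bij (pivot_coords J i a)"
    by (rule o_bij[where g = "\<lambda>v k. if k = i then a i * v i else if k \<in> J then v k + v i * a k else v k"])
      (use assms in \<open>auto simp: pivot_coords_def fun_eq_iff\<close>)
  then show ?thesis
    by (simp add: linear_coords_def pivot_coords_def add_divide_distrib algebra_simps)
qed

text \<open>
  If \<open>r\<close> is the grading of the basis, the vectors whose coordinates vanish on an up-closed set of indices
  form a member of the filtration. Phrasing adaptedness with up-closed sets instead of
  bounds on \<open>r\<close> lets the result be used for every other grading that orders the indices in the same way.
\<close>

definition upclosed :: "(nat \<Rightarrow> 'o::linorder) \<Rightarrow> nat set \<Rightarrow> bool" where
  "upclosed r S \<longleftrightarrow> (\<forall>i\<in>S. \<forall>k. r i \<le> r k \<longrightarrow> k \<in> S)"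

definition vanishes :: "nat set \<Rightarrow> (nat \<Rightarrow> 'k::zero) \<Rightarrow> bool" where
  "vanishes S v \<longleftrightarrow> (\<forall>i\<in>S. v i = 0)"

lemma vanishes_pivot:
  assumes "i \<in> S" "a i \<noteq> 0"
  shows "vanishes S (pivot_coords J i a v) \<longleftrightarrow> vanishes S v"
proof -
  have "pivot_coords J i a v i = 0 \<longleftrightarrow> v i = 0"
    using assms(2) by (simp add: pivot_coords_def)
  moreover have "pivot_coords J i a v k = 0 \<longleftrightarrow> v k = 0" if "v i = 0" for k
    using that by (simp add: pivot_coords_def)
  ultimately show ?thesis
    using \<open>i \<in> S\<close> unfolding vanishes_def by blast
qed

text \<open>
  The new basis vector is a combination of vectors of grade at most \<open>r i\<close> in which \<open>b\<^sub>i\<close> occurs, so the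
  exchange preserves the filtration. This is why the pivot must have maximal grade in \<open>J\<close>.
\<close>

lemma vanishes_pivot_upclosed:
  assumes "upclosed r S" "i \<in> J" "\<And>k. k \<in> J \<Longrightarrow> r k \<le> r i" "a i \<noteq> 0"
  shows "vanishes S (pivot_coords J i a v) \<longleftrightarrow> vanishes S v"
proof (cases "J \<inter> S = {}")
  case True
  then have "pivot_coords J i a v k = v k" if "k \<in> S" for k
    using that assms(2) by (auto simp: pivot_coords_def)
  then show ?thesis by (simp add: vanishes_def)
next
  case False
  then have "i \<in> S" using assms by (auto simp: upclosed_def)
  then show ?thesis using assms(4) by (rule vanishes_pivot)
qed

text \<open>
  Column reduction of a matrix, read as a proof that two filtrations have a common adapted basis. The
  standard basis is adapted to the grading \<open>r\<close>. Adding the vectors of \<open>ws\<close> one by one, each of them is either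
  in the span of its predecessors, or, modulo this span, a combination of basis vectors not used so far; in the
  latter case it replaces the one among them of highest grade. Then \<open>e i = Some j\<close> records that the
  \<open>i\<close>-th basis vector enters the span with \<open>ws ! j\<close>.
\<close>

lemma common_adapted_coords:
  fixes r :: "nat \<Rightarrow> 'o::linorder" and ws :: "(nat \<Rightarrow> 'k::field) list"
  assumes supp: "\<And>w. w \<in> set ws \<Longrightarrow> vanishes {n..} w"
    and up: "upclosed r {n..}"
  shows "\<exists>\<Phi> e. linear_coords \<Phi> \<and>
    (\<forall>S v. upclosed r S \<longrightarrow> (vanishes S (\<Phi> v) \<longleftrightarrow> vanishes S v)) \<and>
    (\<forall>i j. e i = Some j \<longrightarrow> j < length ws) \<and>
    (\<forall>t\<le>length ws. \<forall>v. v \<in> comb_span (take t ws) \<longleftrightarrow> vanishes {i. \<forall>j<t. e i \<noteq> Some j} (\<Phi> v))"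
  using supp
proof (induction ws rule: rev_induct)
  case Nil
  show ?case
    by (rule exI[of _ id], rule exI[of _ "\<lambda>_. None"])
      (auto simp: linear_coords_def comb_span_Nil vanishes_def bij_id[unfolded id_def])
next
  case (snoc w ws)
  have "\<And>w. w \<in> set ws \<Longrightarrow> vanishes {n..} w"
    using snoc.prems by simp
  from snoc.IH[OF this] obtain \<Phi> :: "(nat \<Rightarrow> 'k) \<Rightarrow> nat \<Rightarrow> 'k" and e where lin: "linear_coords \<Phi>"
    and van: "\<And>S v. upclosed r S \<Longrightarrow> vanishes S (\<Phi> v) \<longleftrightarrow> vanishes S v"
    and ran: "\<And>i j. e i = Some j \<Longrightarrow> j < length ws"
    and span: "\<And>t v. t \<le> length ws \<Longrightarrow>
      v \<in> comb_span (take t ws) \<longleftrightarrow> vanishes {i. \<forall>j<t. e i \<noteq> Some j} (\<Phi> v)"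
    by blast
  define a where "a = \<Phi> w"
  \<comment> \<open>Up to vectors in the span of its predecessors, \<open>w\<close> is the combination of the basis vectors in \<open>J\<close>.\<close>
  define J where "J = {k. e k = None \<and> a k \<noteq> 0}"
  have free: "{i. \<forall>j<t. e i \<noteq> Some j} = {i. e i = None}" if "length ws \<le> t" for t
  proof -
    have "(\<forall>j<t. e i \<noteq> Some j) \<longleftrightarrow> e i = None" for i
      using ran[of i] that by (cases "e i") auto
    then show ?thesis by simp
  qed
  have \<Phi>_diff: "\<Phi> (\<lambda>i. v i - c * w i) k = \<Phi> v k - c * a k" for v c k
  proof -
    have "\<Phi> (\<lambda>i. v i + (- c) * w i) k = \<Phi> v k + (- c) * a k"
      using lin unfolding linear_coords_def a_def by (simp only:)
    then show ?thesis by simp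
  qed
  have new: "v \<in> comb_span (ws @ [w]) \<longleftrightarrow> (\<exists>c. \<forall>k. e k = None \<longrightarrow> \<Phi> v k = c * a k)" for v
    using span[of "length ws"] by (simp add: comb_span_snoc free vanishes_def \<Phi>_diff)
  show ?case
  proof (cases "J = {}")
    case True
    show ?thesis
    proof (intro exI[of _ \<Phi>] exI[of _ e] conjI allI impI)
      show "j < length (ws @ [w])" if "e k = Some j" for k j
        using ran[OF that] by simp
      fix t v assume "t \<le> length (ws @ [w])"
      show "v \<in> comb_span (take t (ws @ [w])) \<longleftrightarrow> vanishes {i. \<forall>j<t. e i \<noteq> Some j} (\<Phi> v)"
      proof (cases "t \<le> length ws")
        case False
        then have t: "t = Suc (length ws)" using \<open>t \<le> length (ws @ [w])\<close> by simp
        have "e k = None \<Longrightarrow> a k = 0" for k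
          using True unfolding J_def by blast
        then show ?thesis using new[of v] t free[of t] by (auto simp: vanishes_def)
      qed (use span in simp)
    next
      show "linear_coords \<Phi>" by (rule lin)
      show "vanishes S (\<Phi> v) \<longleftrightarrow> vanishes S v" if "upclosed r S" for S v
        by (rule van[OF that])
    qed
  next
    case False
    have "vanishes {n..} a"
      using snoc.prems[of w] van[OF up] by (simp add: a_def)
    then have "k < n" if "k \<in> J" for k
      using that by (cases "k < n") (simp_all add: vanishes_def J_def)
    then have "finite J" using finite_subset[of J "{..<n}"] by auto
    have "Max (r ` J) \<in> r ` J"
      using \<open>finite J\<close> False by (intro Max_in) auto
    then obtain i where "i \<in> J" "r i = Max (r ` J)" by auto
    then have i: "i \<in> J" "\<And>k. k \<in> J \<Longrightarrow> r k \<le> r i"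
      using \<open>finite J\<close> by simp_all
    then have ai: "a i \<noteq> 0" and ei: "e i = None" by (auto simp: J_def)
    define \<Phi>' where "\<Phi>' = pivot_coords J i a \<circ> \<Phi>"
    define e' where "e' = e(i \<mapsto> length ws)"
    show ?thesis
    proof (intro exI[of _ \<Phi>'] exI[of _ e'] conjI allI impI)
      show "linear_coords \<Phi>'"
        unfolding \<Phi>'_def by (intro linear_coords_comp lin linear_coords_pivot ai)
      show "vanishes S (\<Phi>' v) \<longleftrightarrow> vanishes S v" if "upclosed r S" for S v
        using vanishes_pivot_upclosed[of r S i J a, OF that i(1) i(2) ai] van[OF that] by (simp add: \<Phi>'_def)
      show "j < length (ws @ [w])" if "e' k = Some j" for k j
        using that ran[of k j] by (cases "k = i") (simp_all add: e'_def)
      fix t v assume "t \<le> length (ws @ [w])"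
      show "v \<in> comb_span (take t (ws @ [w])) \<longleftrightarrow> vanishes {i. \<forall>j<t. e' i \<noteq> Some j} (\<Phi>' v)"
      proof (cases "t \<le> length ws")
        case True
        let ?T = "{i. \<forall>j<t. e i \<noteq> Some j}"
        have "{i. \<forall>j<t. e' i \<noteq> Some j} = ?T"
          using True ei by (auto simp: e'_def)
        moreover have "vanishes ?T (pivot_coords J i a (\<Phi> v)) \<longleftrightarrow> vanishes ?T (\<Phi> v)"
          by (rule vanishes_pivot) (simp_all add: ei ai)
        ultimately show ?thesis using True span by (simp add: \<Phi>'_def)
      next
        case False
        then have t: "t = Suc (length ws)" using \<open>t \<le> length (ws @ [w])\<close> by simp
        have T: "{k. \<forall>j<t. e' k \<noteq> Some j} = {k. e k = None} - {i}"
        proof -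
          have "(\<forall>j<t. e' k \<noteq> Some j) \<longleftrightarrow> (\<forall>j<length ws. e k \<noteq> Some j) \<and> k \<noteq> i" for k
          proof (cases "k = i")
            case False
            then show ?thesis using ran[of k] by (auto simp: e'_def t less_Suc_eq)
          qed (simp add: e'_def t)
          then show ?thesis using free[of "length ws"] by auto
        qed
        have "(\<exists>c. \<forall>k. e k = None \<longrightarrow> \<Phi> v k = c * a k) \<longleftrightarrow>
              (\<forall>k. e k = None \<longrightarrow> \<Phi> v k = \<Phi> v i / a i * a k)"
        proof
          assume "\<exists>c. \<forall>k. e k = None \<longrightarrow> \<Phi> v k = c * a k"
          then obtain c where c: "\<And>k. e k = None \<Longrightarrow> \<Phi> v k = c * a k" by blast
          then show "\<forall>k. e k = None \<longrightarrow> \<Phi> v k = \<Phi> v i / a i * a k"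
            using c[OF ei] ai by simp
        qed blast
        also have "\<dots> \<longleftrightarrow> vanishes ({k. e k = None} - {i}) (\<Phi>' v)"
        proof -
          have "\<Phi>' v k = \<Phi> v k - \<Phi> v i / a i * a k" if "e k = None" "k \<noteq> i" for k
            using that by (simp add: \<Phi>'_def pivot_coords_def J_def)
          then show ?thesis using ai by (auto simp: vanishes_def)
        qed
        finally show ?thesis using new[of v] unfolding T by (simp add: t)
      qed
    qed
  qed
qed

section \<open>Uniqueness of persistence diagrams\<close>

definition bars_containing :: "(real \<times> ereal) multiset \<Rightarrow> real \<Rightarrow> real \<Rightarrow> (real \<times> ereal) multiset" where
  "bars_containing D x y = filter_mset (\<lambda>(b, d). b \<le> x \<and> ereal y < d) D"

text \<open>
  After removing the common part of two different diagrams, take the smallest birth \<open>b\<close> that is left and the largest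
  death \<open>d\<close> among the bars born at \<open>b\<close>. For \<open>y\<close> in \<open>[b, d)\<close> beyond all deaths smaller than \<open>d\<close>, the remaining
  bars that contain \<open>[b, y]\<close> are the copies of \<open>(b, d)\<close>, and these are left on one side only.
\<close>

lemma diagram_eqI:
  fixes D1 D2 :: "(real \<times> ereal) multiset"
  assumes bars: "\<And>b d. (b, d) \<in># D1 + D2 \<Longrightarrow> ereal b < d"
    and sizes: "\<And>x y. x \<le> y \<Longrightarrow> size (bars_containing D1 x y) = size (bars_containing D2 x y)"
  shows "D1 = D2"
proof (rule ccontr)
  assume "D1 \<noteq> D2"
  define E1 where "E1 = D1 - D2"
  define E2 where "E2 = D2 - D1"
  define E where "E = E1 + E2"
  have split1: "D1 = E1 + D1 \<inter># D2" and split2: "D2 = E2 + D1 \<inter># D2"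
    by (auto simp: E1_def E2_def multiset_eq_iff)
  have disj: "count E1 u = 0 \<or> count E2 u = 0" for u
    by (auto simp: E1_def E2_def)
  have "E \<noteq> {#}"
    using \<open>D1 \<noteq> D2\<close> split1 split2 by (auto simp: E_def)
  have E_sub: "set_mset E \<subseteq> set_mset (D1 + D2)"
    by (auto simp: E_def E1_def E2_def dest: in_diffD)
  define b where "b = Min (fst ` set_mset E)"
  have b_min: "b \<le> b'" if "(b', d') \<in># E" for b' d'
    unfolding b_def by (rule Min_le) (use imageI[OF that, of fst] in simp_all)
  have "b \<in> fst ` set_mset E"
    unfolding b_def using \<open>E \<noteq> {#}\<close> by (intro Min_in) auto
  define Y where "Y = {d. (b, d) \<in># E}"
  have Y_eq: "Y = snd ` {u \<in> set_mset E. fst u = b}"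
    by (force simp: Y_def)
  have Y: "finite Y" "Y \<noteq> {}"
    using \<open>b \<in> fst ` set_mset E\<close> by (auto simp: Y_eq)
  define d where "d = Max Y"
  have "d \<in> Y" unfolding d_def using Y by (rule Max_in)
  then have bd: "(b, d) \<in># E" by (simp add: Y_def)
  have d_max: "d' \<le> d" if "(b, d') \<in># E" for d'
    unfolding d_def by (rule Max_ge) (use that Y in \<open>simp_all add: Y_def\<close>)
  have "ereal b < d" using bd bars E_sub by blast
  \<comment> \<open>The maximum of \<open>Z\<close> is the smallest possible \<open>y\<close>; it is finite as it lies between \<open>b\<close> and \<open>d\<close>.\<close>
  define Z where "Z = insert (ereal b) {d' \<in> snd ` set_mset E. d' < d}"
  have Z: "finite Z" "Z \<noteq> {}" "\<And>z. z \<in> Z \<Longrightarrow> z < d"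
    using \<open>ereal b < d\<close> by (auto simp: Z_def)
  have "Max Z \<in> Z" using Z(1,2) by (rule Max_in)
  have "ereal b \<le> Max Z"
    by (rule Max_ge[OF Z(1)]) (simp add: Z_def)
  then obtain y where y: "ereal y = Max Z" "b \<le> y" "ereal y < d"
    using Z(3)[OF \<open>Max Z \<in> Z\<close>] by (cases "Max Z") auto
  have key: "b' \<le> b \<and> ereal y < d' \<longleftrightarrow> (b', d') = (b, d)" if "(b', d') \<in># E" for b' d'
  proof -
    have "\<not> d' < d" if "ereal y < d'"
    proof
      assume "d' < d"
      then have "d' \<in> Z" using imageI[OF \<open>(b', d') \<in># E\<close>, of snd] by (simp add: Z_def)
      then have "d' \<le> ereal y" using Z(1) y(1) by simp
      then show False using that by simp
    qed
    then show ?thesis using b_min[OF that] d_max[of d'] that y(3) by (auto simp: not_less)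
  qed
  have count: "size (bars_containing F b y) = count F (b, d)" if "set_mset F \<subseteq> set_mset E" for F
  proof -
    have "bars_containing F b y = filter_mset (\<lambda>u. u = (b, d)) F"
      unfolding bars_containing_def using key that by (intro filter_mset_cong) auto
    then show ?thesis by (simp add: filter_eq_replicate_mset)
  qed
  have "size (bars_containing D1 b y) = size (bars_containing E1 b y) + size (bars_containing (D1 \<inter># D2) b y)"
    by (subst split1) (simp add: bars_containing_def)
  moreover have "size (bars_containing D2 b y) = size (bars_containing E2 b y) + size (bars_containing (D1 \<inter># D2) b y)"
    by (subst split2) (simp add: bars_containing_def)
  ultimately have "count E1 (b, d) = count E2 (b, d)"
    using sizes[OF y(2)] count[of E1] count[of E2] by (simp add: E_def)
  moreover have "count E1 (b, d) + count E2 (b, d) \<noteq> 0"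
    using bd count_union[of E1 E2 "(b, d)"] not_in_iff[of "(b, d)" E] by (simp add: E_def)
  ultimately show False using disj[of "(b, d)"] by linarith
qed

lemma two_le_card_field: "2 \<le> CARD('k::{field, finite})"
proof -
  have "card {0, 1 :: 'k} \<le> CARD('k)" by (intro card_mono) auto
  then show ?thesis by simp
qed

lemma linear_map_closed:
  "linear_map K V W T \<Longrightarrow> v \<in> carrier V \<Longrightarrow> T v \<in> carrier W"
  unfolding linear_map_def by (auto intro: mod_hom.f_im[of K V W])

lemma persistence_module_pmap_closed:
  assumes "persistence_module M" "x \<le> y" "v \<in> carrier (pspace M x)"
  shows "pmap M x y v \<in> carrier (pspace M y)"
proof -
  have "linear_map class_ring (pspace M x) (pspace M y) (pmap M x y)"
    using assms(1,2) unfolding persistence_module_def by simp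
  then show ?thesis using assms(3) by (rule linear_map_closed)
qed

text \<open>
  Cardinality replaces the rank of a structure map here: over a finite field it carries the same
  information, and it is preserved by bijections that commute with the structure maps.
\<close>

lemma card_image_pmap_iso:
  assumes M: "persistence_module M" and iso: "pm_iso M N" and "x \<le> y"
  shows "card (pmap M x y ` carrier (pspace M x)) = card (pmap N x y ` carrier (pspace N x))"
proof -
  obtain h where h: "\<And>x. bij_betw (h x) (carrier (pspace M x)) (carrier (pspace N x))"
    "\<And>v. v \<in> carrier (pspace M x) \<Longrightarrow> h y (pmap M x y v) = pmap N x y (h x v)"
    using iso \<open>x \<le> y\<close> unfolding pm_iso_def by blast
  have sub: "pmap M x y ` carrier (pspace M x) \<subseteq> carrier (pspace M y)"
    using persistence_module_pmap_closed[OF M \<open>x \<le> y\<close>] by blast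
  have "pmap N x y ` carrier (pspace N x) = h y ` pmap M x y ` carrier (pspace M x)"
    using h(2) unfolding bij_betw_imp_surj_on[OF h(1)[of x], symmetric] image_image
    by (intro image_cong) auto
  then show ?thesis
    using inj_on_subset[OF bij_betw_imp_inj_on[OF h(1)] sub] by (simp add: card_image)
qed

lemma card_image_pmap_intervals:
  fixes xs :: "(real \<times> ereal) list"
  defines "S \<equiv> pm_direct_sum {..<length xs} (\<lambda>i. interval_module (xs ! i)) :: (real, 'k::{field, finite}, nat \<Rightarrow> 'k) pers_module"
  assumes "x \<le> y"
  shows "card (pmap S x y ` carrier (pspace S x)) = CARD('k) ^ size (bars_containing (mset xs) x y)"
proof -
  define P where "P = (\<lambda>(b, d). b \<le> x \<and> ereal y < d)"
  define B where "B i = (if P (xs ! i) then UNIV else {0 :: 'k})" for i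
  have car: "carrier (pspace S x) = (\<Pi>\<^sub>E i\<in>{..<length xs}.
      if fst (xs ! i) \<le> x \<and> ereal x < snd (xs ! i) then UNIV else {0})"
    by (simp add: S_def pm_direct_sum_def interval_module_def case_prod_unfold)
  have pm: "pmap S x y = (\<lambda>v. \<lambda>i\<in>{..<length xs}. if ereal y < snd (xs ! i) then v i else 0)"
    by (simp add: S_def pm_direct_sum_def interval_module_def case_prod_unfold)
  have xy: "ereal x < d" if "ereal y < d" for d
    using that \<open>x \<le> y\<close> by (meson ereal_less_eq(3) order_le_less_trans)
  have "pmap S x y ` carrier (pspace S x) = (\<Pi>\<^sub>E i\<in>{..<length xs}. B i)"
  proof (intro subset_antisym subsetI)
    fix v assume "v \<in> pmap S x y ` carrier (pspace S x)"
    then obtain u where u: "u \<in> carrier (pspace S x)" "v = pmap S x y u" by blast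
    have "v i \<in> B i" if "i < length xs" for i
      using PiE_mem[OF u(1)[unfolded car], of i] that xy
      by (auto simp: u(2) pm B_def P_def case_prod_unfold split: if_splits)
    then show "v \<in> (\<Pi>\<^sub>E i\<in>{..<length xs}. B i)"
      by (simp add: PiE_iff u(2) pm)
  next
    fix v assume v: "v \<in> (\<Pi>\<^sub>E i\<in>{..<length xs}. B i)"
    have "v i = 0" if "i < length xs" "\<not> P (xs ! i)" for i
      using PiE_mem[OF v, of i] that by (simp add: B_def)
    then have "v \<in> carrier (pspace S x)" "pmap S x y v = v"
      using v xy unfolding pm car by (auto simp: PiE_iff P_def case_prod_unfold extensional_def restrict_def)
    then show "v \<in> pmap S x y ` carrier (pspace S x)" by force
  qed
  also have "card \<dots> = (\<Prod>i<length xs. if P (xs ! i) then CARD('k) else 1)"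
    by (simp add: card_PiE B_def if_distrib[of card] cong: if_cong)
  also have "\<dots> = CARD('k) ^ card {i. i < length xs \<and> P (xs ! i)}"
    by (simp add: prod.If_cases Int_def)
  also have "card {i. i < length xs \<and> P (xs ! i)} = size (bars_containing (mset xs) x y)"
    unfolding bars_containing_def P_def[symmetric]
    by (simp add: length_filter_conv_card flip: mset_filter)
  finally show ?thesis .
qed

lemma persistence_diagram_eqI:
  fixes M :: "(real, 'k::{field, finite}, 'v) pers_module"
  assumes M: "persistence_module M" and D: "is_persistence_diagram M D"
  shows "persistence_diagram M = D"
proof -
  have size: "CARD('k) ^ size (bars_containing D' x y) = card (pmap M x y ` carrier (pspace M x))"
    if D': "is_persistence_diagram M D'" and "x \<le> y" for D' x y
  proof -
    obtain xs where xs: "mset xs = D'"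
      and iso: "pm_iso M (pm_direct_sum {..<length xs} (\<lambda>i. interval_module (xs ! i)))"
      using D' unfolding is_persistence_diagram_def by blast
    show ?thesis
      unfolding card_image_pmap_iso[OF M iso \<open>x \<le> y\<close>] card_image_pmap_intervals[OF \<open>x \<le> y\<close>] xs ..
  qed
  have "D' = D" if "is_persistence_diagram M D'" for D'
  proof (rule diagram_eqI)
    show "ereal b < d" if "(b, d) \<in># D' + D" for b d
      using that D \<open>is_persistence_diagram M D'\<close> by (auto simp: is_persistence_diagram_def)
    show "size (bars_containing D' x y) = size (bars_containing D x y)" if "x \<le> y" for x y
    proof (rule power_inject_exp[THEN iffD1])
      show "1 < CARD('k)"
        using two_le_card_field[where 'k = 'k] by simp
      show "CARD('k) ^ size (bars_containing D' x y) = CARD('k) ^ size (bars_containing D x y)"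
        using size[OF \<open>is_persistence_diagram M D'\<close> that] size[OF D that] by simp
    qed
  qed
  then show ?thesis
    unfolding persistence_diagram_def using D by (intro the_equality)
qed

section \<open>Interval decomposition of quotients of filtrations\<close>

lemma linear_mapI:
  assumes "vectorspace class_ring V" "vectorspace class_ring W"
    and "\<And>v. v \<in> carrier V \<Longrightarrow> T v \<in> carrier W"
    and "\<And>v w. v \<in> carrier V \<Longrightarrow> w \<in> carrier V \<Longrightarrow> T (v \<oplus>\<^bsub>V\<^esub> w) = T v \<oplus>\<^bsub>W\<^esub> T w"
    and "\<And>c v. v \<in> carrier V \<Longrightarrow> T (c \<odot>\<^bsub>V\<^esub> v) = c \<odot>\<^bsub>W\<^esub> T v"
  shows "linear_map (class_ring :: 'k::field ring) V W T"
proof -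
  interpret V: vectorspace "class_ring :: 'k ring" V by fact
  interpret W: vectorspace "class_ring :: 'k ring" W by fact
  show ?thesis
    by unfold_locales (use assms in \<open>auto simp: module_hom_def\<close>)
qed

lemma linear_map_add:
  "linear_map K V W T \<Longrightarrow> v \<in> carrier V \<Longrightarrow> w \<in> carrier V \<Longrightarrow> T (v \<oplus>\<^bsub>V\<^esub> w) = T v \<oplus>\<^bsub>W\<^esub> T w"
  by (rule module_hom_add[of _ K]) (auto simp: linear_map_def intro: mod_hom.f_hom)

lemma linear_map_smult:
  "linear_map (class_ring :: 'k::field ring) V W T \<Longrightarrow> v \<in> carrier V \<Longrightarrow> T (c \<odot>\<^bsub>V\<^esub> v) = c \<odot>\<^bsub>W\<^esub> T v"
  by (rule module_hom_smult[of _ "class_ring :: 'k ring"]) (auto simp: linear_map_def intro: mod_hom.f_hom)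

lemma linear_map_comp:
  assumes T: "linear_map (class_ring :: 'k::field ring) U V T" and S: "linear_map class_ring V W S"
  shows "linear_map (class_ring :: 'k::field ring) U W (S \<circ> T)"
proof (rule linear_mapI)
  show "vectorspace class_ring U" "vectorspace class_ring W"
    using T S by (auto simp: linear_map_def)
qed (simp_all add: linear_map_closed[OF T] linear_map_closed[OF S] linear_map_add[OF T]
    linear_map_add[OF S] linear_map_smult[OF T] linear_map_smult[OF S])

lemma pm_iso_trans:
  assumes "pm_iso M Q" "pm_iso Q S"
  shows "pm_iso M S"
proof -
  obtain h where h: "\<And>x. linear_map class_ring (pspace M x) (pspace Q x) (h x)"
    "\<And>x. bij_betw (h x) (carrier (pspace M x)) (carrier (pspace Q x))"
    "\<And>x y v. x \<le> y \<Longrightarrow> v \<in> carrier (pspace M x) \<Longrightarrow> h y (pmap M x y v) = pmap Q x y (h x v)"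
    using assms(1) unfolding pm_iso_def by blast
  obtain k where k: "\<And>x. linear_map class_ring (pspace Q x) (pspace S x) (k x)"
    "\<And>x. bij_betw (k x) (carrier (pspace Q x)) (carrier (pspace S x))"
    "\<And>x y v. x \<le> y \<Longrightarrow> v \<in> carrier (pspace Q x) \<Longrightarrow> k y (pmap Q x y v) = pmap S x y (k x v)"
    using assms(2) unfolding pm_iso_def by blast
  show ?thesis
    unfolding pm_iso_def
  proof (intro exI[of _ "\<lambda>x. k x \<circ> h x"] conjI allI impI ballI)
    show "linear_map class_ring (pspace M x) (pspace S x) (k x \<circ> h x)" for x
      by (rule linear_map_comp[OF h(1) k(1)])
    show "bij_betw (k x \<circ> h x) (carrier (pspace M x)) (carrier (pspace S x))" for x
      by (rule bij_betw_trans[OF h(2) k(2)])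
    show "(k y \<circ> h y) (pmap M x y v) = pmap S x y ((k x \<circ> h x) v)"
      if "x \<le> y" "v \<in> carrier (pspace M x)" for x y v
      using that by (simp add: h(3) k(3) linear_map_closed[OF h(1)])
  qed
qed

text \<open>
  Needed because a linear map is required to have vector spaces as domain and codomain.
\<close>

lemma vectorspace_sum_of_intervals:
  "vectorspace (class_ring :: 'k::field ring)
     (pspace (pm_direct_sum {..<m} (\<lambda>i. interval_module (u i) :: (real, 'k, 'k) pers_module)) x)"
  (is "vectorspace _ ?V")
proof (rule vs_criteria)
  show "field (class_ring :: 'k ring)" by (rule class_field)
  define C where "C i = (if fst (u i) \<le> x \<and> ereal x < snd (u i) then UNIV else {0 :: 'k})" for i
  have V: "carrier ?V = (\<Pi>\<^sub>E i\<in>{..<m}. C i)" "zero ?V = (\<lambda>i\<in>{..<m}. 0)"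
    "add ?V = (\<lambda>v w. \<lambda>i\<in>{..<m}. v i + w i)" "module.smult ?V = (\<lambda>c v. \<lambda>i\<in>{..<m}. c * v i)"
    by (simp_all add: pm_direct_sum_def interval_module_def C_def case_prod_unfold)
  have C: "0 \<in> C i" "a \<in> C i \<Longrightarrow> b \<in> C i \<Longrightarrow> a + b \<in> C i" "a \<in> C i \<Longrightarrow> c * a \<in> C i" "a \<in> C i \<Longrightarrow> - a \<in> C i"
    for i a b c
    by (auto simp: C_def)
  show "\<forall>v\<in>carrier ?V. \<exists>neg_v\<in>carrier ?V. v \<oplus>\<^bsub>?V\<^esub> neg_v = \<zero>\<^bsub>?V\<^esub>"
  proof
    fix v assume "v \<in> carrier ?V"
    then show "\<exists>neg_v\<in>carrier ?V. v \<oplus>\<^bsub>?V\<^esub> neg_v = \<zero>\<^bsub>?V\<^esub>"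
      unfolding V
      by (intro bexI[of _ "\<lambda>i\<in>{..<m}. - v i"]) (auto simp: PiE_iff intro: C)
  qed
qed (auto simp: pm_direct_sum_def interval_module_def case_prod_unfold PiE_iff fun_eq_iff
    restrict_def extensional_def algebra_simps split: if_splits)


text \<open>
  Coordinates \<open>\<phi>\<close> on \<open>K\<^sup>n\<close> in which both filtrations consist of coordinate subspaces: the \<open>i\<close>-th basis vector
  enters \<open>U\<close> at time \<open>r i\<close> and \<open>W\<close> at time \<open>d i\<close>, where \<open>d i = \<infinity>\<close> if it never does. The family of quotients
  \<open>U x / W x\<close> then splits along the coordinates.
\<close>

locale adapted_filtrations =
  fixes n :: nat and \<phi> :: "'k::field Matrix.vec \<Rightarrow> nat \<Rightarrow> 'k"
    and r :: "nat \<Rightarrow> real" and d :: "nat \<Rightarrow> ereal"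
    and U W :: "real \<Rightarrow> 'k Matrix.vec set"
  assumes add: "\<And>v w i. v \<in> carrier_vec n \<Longrightarrow> w \<in> carrier_vec n \<Longrightarrow> \<phi> (v + w) i = \<phi> v i + \<phi> w i"
    and smult: "\<And>c v i. v \<in> carrier_vec n \<Longrightarrow> \<phi> (c \<cdot>\<^sub>v v) i = c * \<phi> v i"
    and surj: "\<And>y. \<exists>v\<in>carrier_vec n. \<forall>i<n. \<phi> v i = y i"
    and U_iff: "\<And>x v. v \<in> U x \<longleftrightarrow> v \<in> carrier_vec n \<and> (\<forall>i<n. x < r i \<longrightarrow> \<phi> v i = 0)"
    and W_iff: "\<And>x v. v \<in> W x \<longleftrightarrow> v \<in> carrier_vec n \<and> (\<forall>i<n. ereal x < d i \<longrightarrow> \<phi> v i = 0)"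
    and W_le_U: "\<And>x. W x \<subseteq> U x"
begin

abbreviation "V \<equiv> module_vec TYPE('k) n"

lemma coset: "W x +>\<^bsub>V\<^esub> u = {w + u |w. w \<in> W x}"
  by (auto simp: a_r_coset_def' module_vec_simps)

lemma zero_in_W: "0\<^sub>v n \<in> W x"
proof -
  have "0 \<cdot>\<^sub>v 0\<^sub>v n = (0\<^sub>v n :: 'k Matrix.vec)" by (intro eq_vecI) auto
  then have "\<phi> (0\<^sub>v n) i = 0" for i
    using smult[of "0\<^sub>v n" 0 i] by simp
  then show ?thesis by (simp add: W_iff)
qed

lemma U_carrier: "u \<in> U x \<Longrightarrow> u \<in> carrier_vec n"
  by (simp add: U_iff)

lemma rep_in_coset: "u \<in> U x \<Longrightarrow> u \<in> W x +>\<^bsub>V\<^esub> u"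
  unfolding coset using zero_in_W U_carrier by (force intro: exI[of _ "0\<^sub>v n"])

definition quotients :: "(real, 'k, 'k Matrix.vec set) pers_module" where
  "quotients = \<lparr>pspace = (\<lambda>x. quotient_space V (U x) (W x)),
     pmap = (\<lambda>x y A. \<Union>a\<in>A. W y +>\<^bsub>V\<^esub> a)\<rparr>"

lemma quotients_carrier:
  "A \<in> carrier (pspace quotients x) \<longleftrightarrow> (\<exists>u\<in>U x. A = W x +>\<^bsub>V\<^esub> u)"
  by (auto simp: quotients_def quotient_space_def)

lemma quotients_memD:
  assumes "A \<in> carrier (pspace quotients x)" "v \<in> A"
  shows "v \<in> U x" "A = W x +>\<^bsub>V\<^esub> v"
proof -
  obtain u where u: "u \<in> U x" "A = W x +>\<^bsub>V\<^esub> u"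
    using assms(1) quotients_carrier by blast
  obtain w where w: "w \<in> W x" "v = w + u"
    using assms(2) by (auto simp: u(2) coset)
  have car: "u \<in> carrier_vec n" "w \<in> carrier_vec n"
    using u(1) w(1) by (simp_all add: U_iff W_iff)
  have "w \<in> U x" using w(1) W_le_U by blast
  then show "v \<in> U x" using u(1) by (simp add: U_iff w(2) add)
  have diff: "w' + w \<in> W x" "w' - w \<in> W x" if "w' \<in> W x" for w'
  proof -
    have "w' - w = w' + (-1) \<cdot>\<^sub>v w" using that w(1) by (auto simp: W_iff)
    then show "w' + w \<in> W x" "w' - w \<in> W x"
      using that w(1) by (simp_all add: W_iff add smult)
  qed
  show "A = W x +>\<^bsub>V\<^esub> v"
  proof (intro subset_antisym subsetI)
    fix z assume "z \<in> A"
    then obtain w' where w': "w' \<in> W x" "z = w' + u" by (auto simp: u(2) coset)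
    have "z = (w' - w) + v"
      using car w'(1) by (intro eq_vecI) (auto simp: w' w(2) W_iff)
    then show "z \<in> W x +>\<^bsub>V\<^esub> v" using diff(2)[OF w'(1)] by (auto simp: coset)
  next
    fix z assume "z \<in> W x +>\<^bsub>V\<^esub> v"
    then obtain w' where w': "w' \<in> W x" "z = w' + v" by (auto simp: coset)
    have "z = (w' + w) + u"
      using car w'(1) by (intro eq_vecI) (auto simp: w' w(2) W_iff)
    then show "z \<in> A" using diff(1)[OF w'(1)] by (auto simp: u(2) coset)
  qed
qed

lemma quotients_eqI:
  assumes "u \<in> U x" "v \<in> U x" "\<And>i. i < n \<Longrightarrow> r i \<le> x \<Longrightarrow> ereal x < d i \<Longrightarrow> \<phi> u i = \<phi> v i"
  shows "W x +>\<^bsub>V\<^esub> u = W x +>\<^bsub>V\<^esub> v"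
proof -
  have car: "u \<in> carrier_vec n" "v \<in> carrier_vec n"
    using assms(1,2) U_carrier by auto
  have "u + (-1) \<cdot>\<^sub>v v \<in> W x"
    unfolding W_iff
  proof (intro conjI allI impI)
    fix i assume i: "i < n" "ereal x < d i"
    have "\<phi> u i = \<phi> v i"
    proof (cases "r i \<le> x")
      case True then show ?thesis using assms(3) i by blast
    next
      case False
      then show ?thesis using assms(1,2) i by (simp add: U_iff)
    qed
    then show "\<phi> (u + (-1) \<cdot>\<^sub>v v) i = 0" using car by (simp add: add smult)
  qed (use car in simp)
  moreover have "u = (u + (-1) \<cdot>\<^sub>v v) + v"
    using car by (intro eq_vecI) auto
  ultimately have "u \<in> W x +>\<^bsub>V\<^esub> v" unfolding coset by blast
  moreover have "W x +>\<^bsub>V\<^esub> v \<in> carrier (pspace quotients x)"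
    using assms(2) quotients_carrier by blast
  ultimately show ?thesis using quotients_memD(2) by simp
qed

text \<open>
  The isomorphism reads off the coordinates that are alive, those with \<open>r i \<le> x < d i\<close>: the others vanish on
  \<open>U x\<close> or are arbitrary on \<open>W x\<close>. Indices without \<open>r i < d i\<close> are never alive and must be left out, since
  a diagram contains proper bars only.
\<close>

lemma quotients_iso_intervals:
  assumes vs: "\<And>x. vectorspace class_ring (pspace quotients x)"
    and closed: "\<And>x y A. x \<le> y \<Longrightarrow> A \<in> carrier (pspace quotients x) \<Longrightarrow>
      pmap quotients x y A \<in> carrier (pspace quotients y)"
    and js: "distinct js" "set js = {i. i < n \<and> ereal (r i) < d i}"
  shows "pm_iso quotients
    (pm_direct_sum {..<length js} (\<lambda>k. interval_module (r (js ! k), d (js ! k))))"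
    (is "pm_iso _ ?S")
proof -
  define I where "I = {..<length js}"
  define alive where "alive x i \<longleftrightarrow> r i \<le> x \<and> ereal x < d i" for x i
  define c where "c x v = (\<lambda>k\<in>I. if alive x (js ! k) then \<phi> v (js ! k) else 0)" for x v
  define h where "h x A = c x (SOME v. v \<in> A)" for x and A :: "'k Matrix.vec set"
  have S: "carrier (pspace ?S x) = (\<Pi>\<^sub>E k\<in>I. if alive x (js ! k) then UNIV else {0})"
    "v \<oplus>\<^bsub>pspace ?S x\<^esub> w = (\<lambda>k\<in>I. v k + w k)" "a \<odot>\<^bsub>pspace ?S x\<^esub> v = (\<lambda>k\<in>I. a * v k)"
    "pmap ?S x y v = (\<lambda>k\<in>I. if ereal y < d (js ! k) then v k else 0)" for x y v w a
    by (simp_all add: pm_direct_sum_def interval_module_def I_def alive_def)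
  have js_n: "js ! k < n" if "k \<in> I" for k
    using js(2) nth_mem[of k js] that by (auto simp: I_def)
  \<comment> \<open>Alive coordinates do not depend on the representative, so any element of a coset may be used.\<close>
  have h_eq: "h x A = c x v" if A: "A \<in> carrier (pspace quotients x)" "v \<in> A" for x A v
  proof -
    define u where "u = (SOME v. v \<in> A)"
    have "u \<in> A" unfolding u_def using \<open>v \<in> A\<close> by (rule someI)
    then have "u \<in> W x +>\<^bsub>V\<^esub> v" using quotients_memD(2)[OF A] by simp
    then obtain w where w: "w \<in> W x" "u = w + v" unfolding coset by blast
    have "v \<in> carrier_vec n" using quotients_memD(1)[OF A] by (rule U_carrier)
    then have "\<phi> u i = \<phi> v i" if "i < n" "alive x i" for i
      using w that by (simp add: W_iff add alive_def)
    then show ?thesis unfolding h_def u_def[symmetric] c_def using js_n by (auto intro!: restrict_ext)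
  qed
  have c_add: "c x (v + w) = c x v \<oplus>\<^bsub>pspace ?S x\<^esub> c x w"
    if "v \<in> carrier_vec n" "w \<in> carrier_vec n" for x v w
    using that by (auto simp: c_def S add intro!: restrict_ext)
  have c_smult: "c x (a \<cdot>\<^sub>v v) = a \<odot>\<^bsub>pspace ?S x\<^esub> c x v" if "v \<in> carrier_vec n" for x a v
    using that by (auto simp: c_def S smult intro!: restrict_ext)
  have nonempty: "\<exists>v. v \<in> A" if "A \<in> carrier (pspace quotients x)" for A x
    using that rep_in_coset quotients_carrier by blast
  have mem_carrier: "v \<in> carrier_vec n" if "A \<in> carrier (pspace quotients x)" "v \<in> A" for A x v
    using quotients_memD(1)[OF that] by (rule U_carrier)
  show ?thesis
    unfolding pm_iso_def
  proof (intro exI[of _ h] conjI allI impI ballI)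
    fix x
    show "linear_map class_ring (pspace quotients x) (pspace ?S x) (h x)"
    proof (rule linear_mapI)
      fix A assume A: "A \<in> carrier (pspace quotients x)"
      show "h x A \<in> carrier (pspace ?S x)"
        by (auto simp: h_def c_def S PiE_iff)
      obtain a where a: "a \<in> A" using nonempty[OF A] by blast
      interpret vectorspace class_ring "pspace quotients x" by (rule vs)
      {
        fix B assume B: "B \<in> carrier (pspace quotients x)"
        obtain b where b: "b \<in> B" using nonempty[OF B] by blast
        have "A \<oplus>\<^bsub>pspace quotients x\<^esub> B = A <+>\<^bsub>V\<^esub> B"
          by (simp add: quotients_def quotient_space_def)
        then have "a + b \<in> A \<oplus>\<^bsub>pspace quotients x\<^esub> B"
          using a b by (auto simp: set_add_def' module_vec_simps)
        from h_eq[OF M.add.m_closed[OF A B] this]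
        show "h x (A \<oplus>\<^bsub>pspace quotients x\<^esub> B) = h x A \<oplus>\<^bsub>pspace ?S x\<^esub> h x B"
          using c_add[OF mem_carrier[OF A a] mem_carrier[OF B b]] h_eq[OF A a] h_eq[OF B b] by simp
      }
      fix e
      have "e \<odot>\<^bsub>pspace quotients x\<^esub> A = (\<Union>a\<in>A. W x +>\<^bsub>V\<^esub> (e \<cdot>\<^sub>v a))"
        by (simp add: quotients_def quotient_space_def module_vec_simps)
      moreover have "e \<cdot>\<^sub>v a \<in> W x +>\<^bsub>V\<^esub> (e \<cdot>\<^sub>v a)"
        using quotients_memD(1)[OF A a] by (intro rep_in_coset) (simp add: U_iff smult)
      ultimately have "e \<cdot>\<^sub>v a \<in> e \<odot>\<^bsub>pspace quotients x\<^esub> A" using a by blast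
      from h_eq[OF _ this]
      show "h x (e \<odot>\<^bsub>pspace quotients x\<^esub> A) = e \<odot>\<^bsub>pspace ?S x\<^esub> h x A"
        using c_smult[OF mem_carrier[OF A a]] h_eq[OF A a] smult_closed[OF _ A] by simp
    qed (use vs vectorspace_sum_of_intervals in auto)
    show "bij_betw (h x) (carrier (pspace quotients x)) (carrier (pspace ?S x))"
      unfolding bij_betw_def
    proof (intro conjI inj_onI)
      fix A B assume A: "A \<in> carrier (pspace quotients x)" and B: "B \<in> carrier (pspace quotients x)"
        and eq: "h x A = h x B"
      obtain a b where ab: "a \<in> A" "b \<in> B" using nonempty[OF A] nonempty[OF B] by blast
      have "\<phi> a i = \<phi> b i" if "i < n" "r i \<le> x" "ereal x < d i" for i
      proof -
        have "ereal (r i) < d i" using that by (meson ereal_less_eq(3) order_le_less_trans)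
        then obtain k where k: "k \<in> I" "js ! k = i"
          using js(2) \<open>i < n\<close> by (auto simp: I_def in_set_conv_nth) (metis mem_Collect_eq in_set_conv_nth)
        have "c x a k = c x b k" using eq h_eq[OF A ab(1)] h_eq[OF B ab(2)] by simp
        then show ?thesis using k that by (simp add: c_def alive_def)
      qed
      then have "W x +>\<^bsub>V\<^esub> a = W x +>\<^bsub>V\<^esub> b"
        using quotients_memD(1)[OF A ab(1)] quotients_memD(1)[OF B ab(2)] by (intro quotients_eqI)
      then show "A = B" using quotients_memD(2)[OF A ab(1)] quotients_memD(2)[OF B ab(2)] by simp
    next
      show "h x ` carrier (pspace quotients x) = carrier (pspace ?S x)"
      proof (intro subset_antisym image_subsetI)
        show "h x A \<in> carrier (pspace ?S x)" for A
          by (auto simp: h_def c_def S PiE_iff)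
      next
        show "carrier (pspace ?S x) \<subseteq> h x ` carrier (pspace quotients x)"
        proof
          fix g assume g: "g \<in> carrier (pspace ?S x)"
          \<comment> \<open>A preimage is built by prescribing the alive coordinates as in \<open>g\<close> and all others as zero.\<close>
          define y where "y i = (if i \<in> set js then g (inv_into I ((!) js) i) else 0)" for i
          have inj: "inj_on ((!) js) I" using js(1) by (simp add: I_def inj_on_nth)
          have y_nth: "y (js ! k) = g k" if "k \<in> I" for k
            using that inj by (simp add: y_def inv_into_f_f) (simp add: I_def)
          obtain v where v: "v \<in> carrier_vec n" "\<forall>i<n. \<phi> v i = y i" using surj[of y] by blast
          have "y i = 0" if "x < r i" for i
          proof (cases "i \<in> set js")
            case True
            then obtain k where k: "k \<in> I" "i = js ! k" by (auto simp: I_def in_set_conv_nth)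
            have "g k = 0"
              using PiE_mem[OF g[unfolded S] k(1)] that by (simp add: k(2) alive_def)
            then show ?thesis using y_nth k by simp
          qed (simp add: y_def)
          then have vU: "v \<in> U x" using v by (simp add: U_iff)
          define A where "A = W x +>\<^bsub>V\<^esub> v"
          have A: "A \<in> carrier (pspace quotients x)" using vU quotients_carrier A_def by blast
          have "h x A = c x v" by (rule h_eq[OF A]) (simp add: A_def rep_in_coset vU)
          also have "c x v = g"
          proof (rule extensionalityI)
            show "g \<in> extensional I" using g by (simp add: S PiE_def)
            show "c x v k = g k" if "k \<in> I" for k
              using PiE_mem[OF g[unfolded S] that] v(2) js_n[OF that] y_nth[OF that] that
              by (auto simp: c_def split: if_splits)
          qed (simp add: c_def)
          finally show "g \<in> h x ` carrier (pspace quotients x)" using A by blast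
        qed
      qed
    qed
  next
    fix x y A assume "x \<le> y" and A: "A \<in> carrier (pspace quotients x)"
    obtain u where u: "u \<in> A" using nonempty[OF A] by blast
    have uU: "u \<in> U x" by (rule quotients_memD(1)[OF A u])
    then have "u \<in> U y" using \<open>x \<le> y\<close> by (auto simp: U_iff)
    then have "u \<in> W y +>\<^bsub>V\<^esub> u" by (rule rep_in_coset)
    then have "u \<in> pmap quotients x y A" using u by (auto simp: quotients_def)
    then have "h y (pmap quotients x y A) = c y u"
      by (rule h_eq[OF closed[OF \<open>x \<le> y\<close> A]])
    also have "c y u = pmap ?S x y (c x u)"
      unfolding S c_def
    proof (rule restrict_ext)
      fix k assume k: "k \<in> I"
      have "ereal x < d (js ! k)" if "ereal y < d (js ! k)"
        using that \<open>x \<le> y\<close> by (meson ereal_less_eq(3) order_le_less_trans)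
      moreover have "\<phi> u (js ! k) = 0" if "x < r (js ! k)"
        using uU js_n[OF k] that by (simp add: U_iff)
      ultimately show "(if alive y (js ! k) then \<phi> u (js ! k) else 0) =
          (if ereal y < d (js ! k)
           then (\<lambda>k\<in>I. if alive x (js ! k) then \<phi> u (js ! k) else 0) k else 0)"
        using k \<open>x \<le> y\<close> by (auto simp: alive_def)
    qed
    finally show "h y (pmap quotients x y A) = pmap ?S x y (h x A)"
      by (simp add: h_eq[OF A u])
  qed
qed

end

section \<open>Spans of generators and relations\<close>

definition vec_fun :: "'k::zero Matrix.vec \<Rightarrow> nat \<Rightarrow> 'k" where
  "vec_fun v i = (if i < dim_vec v then v $ i else 0)"

lemma vec_fun_carrier: "v \<in> carrier_vec n \<Longrightarrow> vec_fun v i = (if i < n then v $ i else 0)"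
  by (auto simp: vec_fun_def)

lemma vec_fun_add: "v \<in> carrier_vec n \<Longrightarrow> w \<in> carrier_vec n \<Longrightarrow> vec_fun (v + w) = (\<lambda>i. vec_fun v i + vec_fun w i)"
  for v w :: "'k::field Matrix.vec"
  by (auto simp: vec_fun_def)

lemma vec_fun_smult: "vec_fun (c \<cdot>\<^sub>v v) = (\<lambda>i. c * vec_fun v i)" for v :: "'k::field Matrix.vec"
  by (auto simp: vec_fun_def)

lemma span_eq_comb_span:
  fixes vs :: "'k::field Matrix.vec list"
  assumes vs: "set vs \<subseteq> carrier_vec n"
  shows "v \<in> LinearCombinations.module.span class_ring (module_vec TYPE('k) n) (set vs) \<longleftrightarrow>
    v \<in> carrier_vec n \<and> vec_fun v \<in> comb_span (map vec_fun vs)"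
proof -
  interpret vec_space "TYPE('k)" n .
  have carrier: "lincomb_list c vs \<in> carrier_vec n" for c
    using lincomb_list_carrier[of vs c] vs by auto
  have index: "lincomb_list c vs $ i = (\<Sum>j<length vs. c j * vec_fun (vs ! j) i)" if "i < n" for c i
  proof -
    have "lincomb_list c vs = mat_of_cols n vs *\<^sub>v vec (length vs) c"
      using vs by (intro lincomb_list_as_mat_mult) auto
    also have "\<dots> $ i = (\<Sum>j<length vs. mat_of_cols n vs $$ (i, j) * c j)"
      using that by (auto simp: scalar_prod_def lessThan_atLeast0)
    also have "\<dots> = (\<Sum>j<length vs. c j * vec_fun (vs ! j) i)"
    proof (rule sum.cong)
      fix j assume "j \<in> {..<length vs}"
      then have j: "j < length vs" "vs ! j \<in> carrier_vec n" using vs by (auto simp: subset_iff)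
      then show "mat_of_cols n vs $$ (i, j) * c j = c j * vec_fun (vs ! j) i"
        using that by (simp add: mat_of_cols_index vec_fun_def)
    qed simp
    finally show ?thesis .
  qed
  have outside: "vec_fun (vs ! j) i = 0" if "j < length vs" "\<not> i < n" for i j
  proof -
    have "vs ! j \<in> carrier_vec n" using that(1) vs nth_mem by blast
    then show ?thesis using that(2) by (auto simp: vec_fun_def)
  qed
  have "v \<in> span (set vs) \<longleftrightarrow> (\<exists>c. v = lincomb_list c vs)"
    unfolding span_list_as_span[OF vs, symmetric] span_list_def by auto
  also have "\<dots> \<longleftrightarrow> v \<in> carrier_vec n \<and> vec_fun v \<in> comb_span (map vec_fun vs)"
  proof
    assume "\<exists>c. v = lincomb_list c vs"
    then obtain c where c: "v = lincomb_list c vs" by blast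
    have "vec_fun v i = (\<Sum>j<length vs. c j * vec_fun (vs ! j) i)" for i
      unfolding c vec_fun_carrier[OF carrier] using index[of i c] outside[of _ i] by simp
    then show "v \<in> carrier_vec n \<and> vec_fun v \<in> comb_span (map vec_fun vs)"
      using carrier[of c] by (auto simp: comb_span_def c)
  next
    assume v: "v \<in> carrier_vec n \<and> vec_fun v \<in> comb_span (map vec_fun vs)"
    then obtain c where c: "\<And>i. vec_fun v i = (\<Sum>j<length vs. c j * vec_fun (vs ! j) i)"
      by (auto simp: comb_span_def)
    have "v = lincomb_list c vs"
    proof (rule eq_vecI)
      show "v $ i = lincomb_list c vs $ i" if "i < dim_vec (lincomb_list c vs)" for i
        using that carrier[of c] index[of i c] c[of i] v vec_fun_carrier[of v n i] by auto
    qed (use v carrier[of c] in auto)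
    then show "\<exists>c. v = lincomb_list c vs" by blast
  qed
  finally show ?thesis .
qed

lemma span_unit_vecs:
  "v \<in> LinearCombinations.module.span class_ring (module_vec TYPE('k::field) n)
      {unit_vec n i | i. i < n \<and> P i} \<longleftrightarrow>
    v \<in> carrier_vec n \<and> (\<forall>i<n. \<not> P i \<longrightarrow> v $ i = 0)"
proof -
  define js where "js = filter P [0..<n]"
  have js: "set js = {i. i < n \<and> P i}" "distinct js" by (auto simp: js_def)
  have set: "{unit_vec n i | i. i < n \<and> P i} = set (map (unit_vec n :: nat \<Rightarrow> 'k Matrix.vec) js)"
    by (auto simp: js)
  have "vec_fun v \<in> comb_span (map vec_fun (map (unit_vec n) js)) \<longleftrightarrow> (\<forall>i<n. \<not> P i \<longrightarrow> v $ i = 0)"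
    if v: "v \<in> carrier_vec n"
  proof -
    have sum: "(\<Sum>j<length js. a j * vec_fun (unit_vec n (js ! j)) i) =
        (if i < n then \<Sum>j | j < length js \<and> js ! j = i. a j else 0)" for a :: "nat \<Rightarrow> 'k" and i
    proof -
      have "a j * vec_fun (unit_vec n (js ! j)) i = (if js ! j = i then if i < n then a j else 0 else 0)"
        if "j < length js" for j
        by (auto simp: vec_fun_def unit_vec_def)
      then have "(\<Sum>j<length js. a j * vec_fun (unit_vec n (js ! j)) i) =
          (\<Sum>j<length js. if js ! j = i then if i < n then a j else 0 else 0)"
        by (intro sum.cong) auto
      also have "\<dots> = (\<Sum>j | j \<in> {..<length js} \<and> js ! j = i. if i < n then a j else 0)"
        by (rule sum.inter_filter[symmetric]) simp
      finally show ?thesis by simp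
    qed
    show ?thesis
    proof
      assume "vec_fun v \<in> comb_span (map vec_fun (map (unit_vec n) js))"
      then obtain a where a: "\<And>i. vec_fun v i = (\<Sum>j<length js. a j * vec_fun (unit_vec n (js ! j)) i)"
        by (auto simp: comb_span_def)
      show "\<forall>i<n. \<not> P i \<longrightarrow> v $ i = 0"
      proof (intro allI impI)
        fix i assume i: "i < n" "\<not> P i"
        then have "js ! j \<noteq> i" if "j < length js" for j
          using nth_mem[OF that] js(1) by auto
        then have empty: "{j. j < length js \<and> js ! j = i} = {}" by blast
        show "v $ i = 0" using a[of i] i v unfolding sum empty by (simp add: vec_fun_def)
      qed
    next
      assume zero: "\<forall>i<n. \<not> P i \<longrightarrow> v $ i = 0"
      have "vec_fun v i = (\<Sum>j<length js. v $ (js ! j) * vec_fun (unit_vec n (js ! j)) i)" for i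
      proof (cases "i < n \<and> P i")
        case True
        then obtain j where j: "j < length js" "js ! j = i" using js(1) by (metis (mono_tags) in_set_conv_nth mem_Collect_eq)
        then have single: "{j'. j' < length js \<and> js ! j' = i} = {j}"
          using js(2) nth_eq_iff_index_eq by blast
        show ?thesis unfolding sum single using True j v by (simp add: vec_fun_def)
      next
        case False
        have "js ! j \<noteq> i" if "j < length js" for j
          using nth_mem[OF that] js(1) False by auto
        then have empty: "{j. j < length js \<and> js ! j = i} = {}" by blast
        show ?thesis unfolding sum empty using False zero v by (auto simp: vec_fun_def)
      qed
      then show "vec_fun v \<in> comb_span (map vec_fun (map (unit_vec n) js))"
        by (auto simp: comb_span_def intro!: exI[of _ "\<lambda>j. v $ (js ! j)"])
    qed
  qed
  then show ?thesis
    unfolding set by (subst span_eq_comb_span) auto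
qed

section \<open>Slices and pushes\<close>

text \<open>
  The parameter of the push of \<open>p\<close>, which is the least \<open>x\<close> with \<open>p \<le> slice_point l x\<close>.
\<close>

definition slice_time :: "real \<times> real \<Rightarrow> real \<times> real \<Rightarrow> real" where
  "slice_time = (\<lambda>(s, t) p. sqrt (1 + s\<^sup>2) * max (fst p) ((snd p - t) / s))"

lemma le_slice_point_iff:
  assumes "l \<in> slice_params"
  shows "p \<le> slice_point l x \<longleftrightarrow> slice_time l p \<le> x"
proof -
  obtain s t where l: "l = (s, t)" "s > 0"
    using assms by (auto simp: slice_params_def)
  define c where "c = sqrt (1 + s\<^sup>2)"
  have "1 + s\<^sup>2 > 0" by (simp add: add_pos_nonneg)
  then have "c > 0" by (simp add: c_def)
  have "p \<le> slice_point l x \<longleftrightarrow> fst p \<le> x / c \<and> snd p \<le> s * x / c + t"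
    by (simp add: l slice_point_def less_eq_prod_def c_def)
  also have "\<dots> \<longleftrightarrow> c * fst p \<le> x \<and> c * ((snd p - t) / s) \<le> x"
    using \<open>c > 0\<close> \<open>s > 0\<close> by (simp add: field_simps)
  also have "\<dots> \<longleftrightarrow> c * max (fst p) ((snd p - t) / s) \<le> x"
    using \<open>c > 0\<close> by (simp add: max_mult_distrib_left)
  finally show ?thesis by (simp add: l slice_time_def c_def)
qed

lemma push_eq_slice_point:
  assumes "l \<in> slice_params"
  shows "push p l = slice_point l (slice_time l p)"
proof -
  obtain s t where l: "l = (s, t)" "s > 0"
    using assms by (auto simp: slice_params_def)
  have "sqrt (1 + s\<^sup>2) \<noteq> 0" by (simp add: add_nonneg_eq_0_iff)
  then have "slice_point l (sqrt (1 + s\<^sup>2) * m) = (m, s * m + t)" for m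
    by (simp add: l slice_point_def)
  moreover have "max (fst p) ((snd p - t) / s) = (if snd p < s * fst p + t then fst p else (snd p - t) / s)"
    using \<open>s > 0\<close> by (auto simp: max_def field_simps)
  ultimately show ?thesis
    using \<open>s > 0\<close> by (simp add: l(1) push_def slice_time_def below_slice_def)
qed

lemma norm_slice_point_diff:
  "norm (slice_point l a - slice_point l b) = \<bar>a - b\<bar>"
proof -
  obtain s t where l: "l = (s, t)" by (cases l)
  define c where "c = sqrt (1 + s\<^sup>2)"
  have pos: "1 + s\<^sup>2 > 0" by (simp add: add_pos_nonneg)
  then have c: "c > 0" "c\<^sup>2 = 1 + s\<^sup>2" by (simp_all add: c_def)
  have "(a / c - b / c)\<^sup>2 + (s * a / c - s * b / c)\<^sup>2 = (a - b)\<^sup>2 * (1 + s\<^sup>2) / c\<^sup>2"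
    using c(1) by (simp add: field_simps power2_eq_square)
  also have "\<dots> = (a - b)\<^sup>2"
    using pos by (simp add: c(2))
  finally show ?thesis
    by (simp add: l slice_point_def norm_Pair c_def)
qed

lemma push_dist_eq:
  assumes "l \<in> slice_params"
  shows "push_dist p q l = \<bar>slice_time l p - slice_time l q\<bar>"
  by (simp add: push_dist_def push_eq_slice_point[OF assms] norm_slice_point_diff)

lemma slice_time_slice_point:
  assumes "l \<in> slice_params"
  shows "slice_time l (slice_point l x) = x"
proof -
  obtain s t where l: "l = (s, t)" "s > 0"
    using assms by (auto simp: slice_params_def)
  have "sqrt (1 + s\<^sup>2) \<noteq> 0" by (simp add: add_nonneg_eq_0_iff)
  then show ?thesis using \<open>s > 0\<close> by (simp add: l(1) slice_time_def slice_point_def)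
qed

lemma slice_point_mono:
  assumes "l \<in> slice_params" "x \<le> y"
  shows "slice_point l x \<le> slice_point l y"
  using assms by (simp add: le_slice_point_iff slice_time_slice_point)

lemma persistence_module_slice:
  assumes "persistence_module M" "l \<in> slice_params"
  shows "persistence_module (slice_module M l)"
  using assms slice_point_mono[OF assms(2)]
  by (simp add: persistence_module_def slice_module_def del: split_paired_All)

lemma pm_iso_slice:
  assumes "pm_iso M N" "l \<in> slice_params"
  shows "pm_iso (slice_module M l) (slice_module N l)"
proof -
  obtain h where h: "\<And>x. linear_map class_ring (pspace M x) (pspace N x) (h x)"
    "\<And>x. bij_betw (h x) (carrier (pspace M x)) (carrier (pspace N x))"
    "\<And>x y v. x \<le> y \<Longrightarrow> v \<in> carrier (pspace M x) \<Longrightarrow> h y (pmap M x y v) = pmap N x y (h x v)"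
    using assms(1) unfolding pm_iso_def by blast
  then show ?thesis
    unfolding pm_iso_def slice_module_def
    by (intro exI[of _ "\<lambda>x. h (slice_point l x)"]) (simp add: slice_point_mono[OF assms(2)])
qed

text \<open>
  Transported from \<open>M\<close> along the isomorphism; for a module of quotients this replaces a computation with
  cosets.
\<close>

lemma pm_iso_pmap_closed:
  assumes M: "persistence_module M" and iso: "pm_iso M Q"
    and "x \<le> y" "A \<in> carrier (pspace Q x)"
  shows "pmap Q x y A \<in> carrier (pspace Q y)"
proof -
  obtain h where h: "\<And>x. bij_betw (h x) (carrier (pspace M x)) (carrier (pspace Q x))"
    "\<And>x y v. x \<le> y \<Longrightarrow> v \<in> carrier (pspace M x) \<Longrightarrow> h y (pmap M x y v) = pmap Q x y (h x v)"
    using iso unfolding pm_iso_def by blast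
  obtain v where v: "v \<in> carrier (pspace M x)" "A = h x v"
    using assms(4) bij_betw_imp_surj_on[OF h(1)[of x]] by blast
  show ?thesis
    using bij_betwE[OF h(1)[of y]] persistence_module_pmap_closed[OF M \<open>x \<le> y\<close> v(1)]
    by (simp add: v(2) h(2)[OF \<open>x \<le> y\<close> v(1), symmetric])
qed

lemma sorted_prefix:
  fixes k :: "'a \<Rightarrow> 'o::linorder"
  assumes "sorted (map k js)"
  shows "\<exists>T\<le>length js. \<forall>t<length js. k (js ! t) \<le> x \<longleftrightarrow> t < T"
  using assms
proof (induction js)
  case (Cons a js)
  then obtain T where T: "T \<le> length js" "\<And>t. t < length js \<Longrightarrow> k (js ! t) \<le> x \<longleftrightarrow> t < T"
    by auto
  show ?case
  proof (cases "k a \<le> x")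
    case True
    then show ?thesis
      using T by (intro exI[of _ "Suc T"]) (auto simp: nth_Cons split: nat.split)
  next
    case False
    have "\<not> k b \<le> x" if "b \<in> set (a # js)" for b
      using False Cons.prems that by fastforce
    then have "\<not> k ((a # js) ! t) \<le> x" if "t < length (a # js)" for t
      using nth_mem[OF that] by blast
    then show ?thesis by (intro exI[of _ 0]) simp
  qed
qed simp

lemma pm_direct_sum_cong:
  assumes "\<And>i. i \<in> I \<Longrightarrow> F i = G i"
  shows "pm_direct_sum I F = pm_direct_sum I G"
  unfolding pm_direct_sum_def using assms
  by (auto intro!: ext restrict_ext PiE_cong)

lemma generator_span_iff:
  "v \<in> generator_span P x \<longleftrightarrow> v \<in> carrier_vec (dim_row (pres_mat P)) \<and>
     (\<forall>i<dim_row (pres_mat P). \<not> row_grades P ! i \<le> x \<longrightarrow> v $ i = 0)"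
  unfolding generator_span_def ambient_space_def by (rule span_unit_vecs)

lemma relation_span_iff:
  fixes P :: "('g::order, 'k::field) presentation"
  assumes "set js = {j. j < dim_col (pres_mat P) \<and> col_grades P ! j \<le> x}"
  shows "v \<in> relation_span P x \<longleftrightarrow> v \<in> carrier_vec (dim_row (pres_mat P)) \<and>
     vec_fun v \<in> comb_span (map (\<lambda>j. vec_fun (col (pres_mat P) j)) js)"
proof -
  have "{col (pres_mat P) j | j. j < dim_col (pres_mat P) \<and> col_grades P ! j \<le> x} =
      set (map (col (pres_mat P)) js)"
    using assms by auto
  then show ?thesis
    unfolding relation_span_def ambient_space_def
    by (simp only:) (subst span_eq_comb_span, auto simp: o_def)
qed

text \<open>
  The condition on the nonzero entries of a presentation says that a relation of grade at most \<open>x\<close>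
  involves only generators of grade at most \<open>x\<close>.
\<close>

lemma relation_span_subset:
  fixes P :: "('g::order, 'k::field) presentation"
  assumes "valid_presentation P"
  shows "relation_span P x \<subseteq> generator_span P x"
proof -
  let ?n = "dim_row (pres_mat P)"
  interpret vec_space "TYPE('k)" ?n .
  have "col (pres_mat P) j \<in> generator_span P x"
    if "j < dim_col (pres_mat P)" "col_grades P ! j \<le> x" for j
    unfolding generator_span_iff
  proof (intro conjI allI impI)
    fix i assume i: "i < ?n" "\<not> row_grades P ! i \<le> x"
    have "\<not> row_grades P ! i \<le> col_grades P ! j" using i(2) that(2) by (meson order_trans)
    then show "col (pres_mat P) j $ i = 0"
      using assms i(1) that(1) by (auto simp: valid_presentation_def)
  qed simp
  then show ?thesis
    unfolding relation_span_def
    unfolding generator_span_def ambient_space_def by (intro span_subsetI) auto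
qed

section \<open>Persistence diagrams along a family of slices\<close>

text \<open>
  A bar is stored as the pair of the row grade at which it is born and the column grade at which it
  dies (\<open>None\<close> if it never dies); inserting the times \<open>\<tau>\<close> of a slice gives its ends.
\<close>

definition bar :: "('g \<Rightarrow> real) \<Rightarrow> 'g \<times> 'g option \<Rightarrow> real \<times> ereal" where
  "bar \<tau> = (\<lambda>(p, q). (\<tau> p, case q of None \<Rightarrow> \<infinity> | Some q \<Rightarrow> ereal (\<tau> q)))"

definition grade_pairs :: "'g multiset \<Rightarrow> ('g \<times> 'g option) set" where
  "grade_pairs G = set_mset G \<times> ({None} \<union> Some ` set_mset G)"

text \<open>
  The subspaces occurring in the two filtrations are determined by the orders of the row and of the column
  grades. As these orders are the same for all slices in \<open>F\<close>, the coordinates obtained from one slice \<open>l\<^sub>0\<close> are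
  adapted to the filtrations of every slice in \<open>F\<close>, and the pairing of rows and columns is always the same.
\<close>

lemma slice_diagrams:
  fixes M :: "(real \<times> real, 'k::{field, finite}, 'a) pers_module"
  assumes M: "persistence_module M" and pres: "is_presentation_of P M"
    and F: "F \<subseteq> slice_params"
    and order: "\<And>p q l l'. p \<in># gr P \<Longrightarrow> q \<in># gr P \<Longrightarrow> l \<in> F \<Longrightarrow> l' \<in> F \<Longrightarrow>
      slice_time l p \<le> slice_time l q \<Longrightarrow> slice_time l' p \<le> slice_time l' q"
  shows "\<exists>A. set_mset A \<subseteq> grade_pairs (gr P) \<and>
    (\<forall>l\<in>F. persistence_diagram (slice_module M l) = image_mset (bar (slice_time l)) A) \<and>
    (\<forall>l\<in>F. \<forall>u\<in>#A. ereal (fst (bar (slice_time l) u)) < snd (bar (slice_time l) u))"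
proof (cases "F = {}")
  case True
  then show ?thesis by (intro exI[of _ "{#}"]) simp
next
  case False
  then obtain l0 where l0: "l0 \<in> F" by blast
  define n where "n = dim_row (pres_mat P)"
  define m where "m = dim_col (pres_mat P)"
  define rg where "rg i = row_grades P ! i" for i
  define cg where "cg j = col_grades P ! j" for j
  have valid: "valid_presentation P" and iso: "pm_iso M (presented_module P)"
    using pres by (simp_all add: is_presentation_of_def)
  have rg: "rg i \<in># gr P" if "i < n" for i
    using that valid by (simp add: rg_def gr_def n_def valid_presentation_def)
  have cg: "cg j \<in># gr P" if "j < m" for j
    using that valid by (simp add: cg_def gr_def m_def valid_presentation_def)
  have order_iff: "slice_time l p \<le> slice_time l q \<longleftrightarrow> slice_time l0 p \<le> slice_time l0 q"
    if "l \<in> F" "p \<in># gr P" "q \<in># gr P" for l p q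
    using order[OF that(2,3)] that(1) l0 by blast
  \<comment> \<open>Relations in the order of their grades, so that each \<open>W x\<close> is spanned by an initial segment.\<close>
  define js where "js = sort_key (\<lambda>j. slice_time l0 (cg j)) [0..<m]"
  have js: "set js = {..<m}" "length js = m" by (auto simp: js_def)
  have js_less: "js ! t < m" if "t < m" for t
    using nth_mem[of t js] that by (simp add: js)
  have sorted: "sorted (map (\<lambda>j. slice_time l (cg j)) js)" if "l \<in> F" for l
  proof -
    have "sorted (map (\<lambda>j. slice_time l0 (cg j)) js)"
      by (simp add: js_def)
    then show ?thesis
      using order_iff[OF that cg cg] js_less by (simp add: sorted_iff_nth_mono js)
  qed
  define ws where "ws = map (\<lambda>j. vec_fun (col (pres_mat P) j)) js"
  \<comment> \<open>The value \<open>\<infinity>\<close> makes vanishing from \<open>n\<close> on one of the up-closed conditions.\<close>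
  define r0 where "r0 i = (if i < n then ereal (slice_time l0 (rg i)) else \<infinity>)" for i
  have len: "length ws = m" by (simp add: ws_def js)
  have supp_ws: "vanishes {n..} w" if "w \<in> set ws" for w
    using that by (auto simp: ws_def vanishes_def vec_fun_def n_def)
  have up_n: "upclosed r0 {n..}"
    by (auto simp: upclosed_def r0_def not_less[symmetric] split: if_splits)
  obtain \<Phi> e where lin: "linear_coords \<Phi>"
    and van: "\<And>S v. upclosed r0 S \<Longrightarrow> vanishes S (\<Phi> v) \<longleftrightarrow> vanishes S v"
    and e: "\<And>i t. e i = Some t \<Longrightarrow> t < m"
    and span: "\<And>t v. t \<le> m \<Longrightarrow>
      v \<in> comb_span (take t ws) \<longleftrightarrow> vanishes {i. \<forall>j<t. e i \<noteq> Some j} (\<Phi> v)"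
    using common_adapted_coords[of ws, OF supp_ws up_n] unfolding len by blast
  define death where "death i = map_option (\<lambda>t. cg (js ! t)) (e i)" for i
  define b where "b l i = bar (slice_time l) (rg i, death i)" for l i
  define bs where "bs = filter (\<lambda>i. ereal (fst (b l0 i)) < snd (b l0 i)) [0..<n]"
  \<comment> \<open>Which bars are empty is again a matter of order, so the same rows give bars on every slice.\<close>
  have b_less: "ereal (fst (b l i)) < snd (b l i) \<longleftrightarrow> ereal (fst (b l0 i)) < snd (b l0 i)"
    if "l \<in> F" "i < n" for l i
  proof (cases "e i")
    case (Some t)
    then have "cg (js ! t) \<in># gr P" using cg js_less e by blast
    then show ?thesis
      using order_iff[OF that(1) _ rg[OF that(2)]] Some
      by (simp add: b_def bar_def death_def not_le[symmetric])
  qed (simp add: b_def bar_def death_def)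
  have bs: "distinct bs" "set bs = {i. i < n \<and> ereal (fst (b l i)) < snd (b l i)}" if "l \<in> F" for l
    using b_less[OF that] by (auto simp: bs_def)
  define A where "A = mset (map (\<lambda>i. (rg i, death i)) bs)"
  have "set_mset A \<subseteq> grade_pairs (gr P)"
  proof -
    have "death i \<in> {None} \<union> Some ` set_mset (gr P)" for i
      using cg js_less e by (cases "e i") (auto simp: death_def)
    then show ?thesis using rg by (auto simp: A_def bs_def grade_pairs_def)
  qed
  moreover have "persistence_diagram (slice_module M l) = image_mset (bar (slice_time l)) A"
    if l: "l \<in> F" for l
  proof -
    have l': "l \<in> slice_params" using F l by blast
    define \<phi> where "\<phi> v = \<Phi> (vec_fun v)" for v
    let ?U = "\<lambda>x. generator_span P (slice_point l x)" and ?W = "\<lambda>x. relation_span P (slice_point l x)"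
    have supp: "\<phi> v i = 0" if "v \<in> carrier_vec n" "\<not> i < n" for v i
      using van[OF up_n, of "vec_fun v"] that
      by (auto simp: vanishes_def \<phi>_def vec_fun_carrier)
    have "adapted_filtrations n \<phi> (\<lambda>i. fst (b l i)) (\<lambda>i. snd (b l i)) ?U ?W"
    proof
      show "\<phi> (v + w) i = \<phi> v i + \<phi> w i" if "v \<in> carrier_vec n" "w \<in> carrier_vec n" for v w i
        using lin vec_fun_add[OF that] by (simp add: \<phi>_def linear_coords_def)
      show "\<phi> (c \<cdot>\<^sub>v v) i = c * \<phi> v i" for c v i
        using lin by (simp add: \<phi>_def linear_coords_def vec_fun_smult)
      show "\<exists>v\<in>carrier_vec n. \<forall>i<n. \<phi> v i = y i" for y
      proof -
        define z where "z i = (if i < n then y i else 0)" for i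
        obtain u where u: "\<Phi> u = z"
          using lin by (metis bij_pointE linear_coords_def)
        have "vanishes {n..} u"
          using van[OF up_n, of u] by (simp add: u vanishes_def z_def)
        then have "vec_fun (vec n u) = u"
          by (auto simp: vec_fun_def vanishes_def)
        then show ?thesis
          by (intro bexI[of _ "vec n u"]) (simp_all add: \<phi>_def u z_def)
      qed
      show "v \<in> ?U x \<longleftrightarrow> v \<in> carrier_vec n \<and> (\<forall>i<n. x < fst (b l i) \<longrightarrow> \<phi> v i = 0)" for x v
      proof (cases "v \<in> carrier_vec n")
        case True
        define S where "S = {n..} \<union> {i. i < n \<and> x < slice_time l (rg i)}"
        have "upclosed r0 S"
          unfolding upclosed_def
        proof (intro ballI allI impI)
          fix i k assume i: "i \<in> S" and le: "r0 i \<le> r0 k"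
          show "k \<in> S"
          proof (cases "k < n")
            case True
            then have "i < n" using le by (simp add: r0_def split: if_splits)
            then have "slice_time l (rg i) \<le> slice_time l (rg k)"
              using order_iff[OF l rg rg] True le by (simp add: r0_def)
            then show ?thesis using i True \<open>i < n\<close> by (auto simp: S_def)
          qed (simp add: S_def)
        qed
        have "v \<in> ?U x \<longleftrightarrow> vanishes S (vec_fun v)"
          using True by (auto simp: generator_span_iff le_slice_point_iff[OF l'] S_def vanishes_def
              vec_fun_carrier[OF True] not_le n_def[symmetric] rg_def[symmetric])
        also have "\<dots> \<longleftrightarrow> vanishes S (\<phi> v)"
          using van[OF \<open>upclosed r0 S\<close>] by (simp add: \<phi>_def)
        also have "\<dots> \<longleftrightarrow> (\<forall>i<n. x < fst (b l i) \<longrightarrow> \<phi> v i = 0)"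
          using supp[OF True] by (auto simp: vanishes_def S_def b_def bar_def)
        finally show ?thesis using True by simp
      qed (simp add: generator_span_iff n_def)
      show "v \<in> ?W x \<longleftrightarrow> v \<in> carrier_vec n \<and> (\<forall>i<n. ereal x < snd (b l i) \<longrightarrow> \<phi> v i = 0)" for x v
      proof (cases "v \<in> carrier_vec n")
        case True
        obtain T where T: "T \<le> m" "\<And>t. t < m \<Longrightarrow> slice_time l (cg (js ! t)) \<le> x \<longleftrightarrow> t < T"
          using sorted_prefix[OF sorted[OF l], of x] js(2) by auto
        have "set (take T js) = {j. j < m \<and> slice_time l (cg j) \<le> x}"
        proof (intro subset_antisym subsetI)
          fix j assume "j \<in> set (take T js)"
          then obtain t where "t < T" "t < m" "j = js ! t"
            using T(1) by (auto simp: in_set_conv_nth js(2))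
          then show "j \<in> {j. j < m \<and> slice_time l (cg j) \<le> x}" using T(2) js_less by simp
        next
          fix j assume j: "j \<in> {j. j < m \<and> slice_time l (cg j) \<le> x}"
          then have "j \<in> set js" by (simp add: js)
          then obtain t where "t < m" "j = js ! t" unfolding in_set_conv_nth js(2) by blast
          then show "j \<in> set (take T js)" using T j by (auto simp: in_set_conv_nth js(2))
        qed
        then have "set (take T js) = {j. j < dim_col (pres_mat P) \<and> col_grades P ! j \<le> slice_point l x}"
          by (simp add: le_slice_point_iff[OF l'] m_def cg_def)
        from relation_span_iff[OF this]
        have "v \<in> ?W x \<longleftrightarrow> vec_fun v \<in> comb_span (take T ws)"
          using True by (simp add: n_def ws_def take_map)
        also have "\<dots> \<longleftrightarrow> vanishes {i. \<forall>j<T. e i \<noteq> Some j} (\<phi> v)"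
          using span[OF T(1)] by (simp add: \<phi>_def)
        also have "\<dots> \<longleftrightarrow> (\<forall>i<n. ereal x < snd (b l i) \<longrightarrow> \<phi> v i = 0)"
        proof -
          have "ereal x < snd (b l i) \<longleftrightarrow> (\<forall>j<T. e i \<noteq> Some j)" for i
          proof (cases "e i")
            case (Some t)
            then show ?thesis using T(2)[OF e[OF Some]] by (auto simp: b_def bar_def death_def not_le[symmetric])
          qed (simp add: b_def bar_def death_def)
          then show ?thesis using supp[OF True] by (auto simp: vanishes_def)
        qed
        finally show ?thesis using True by simp
      next
        case False
        have "?W x \<subseteq> ?U x" by (rule relation_span_subset[OF valid])
        then show ?thesis using False by (auto simp: generator_span_iff n_def)
      qed
      show "?W x \<subseteq> ?U x" for x by (rule relation_span_subset[OF valid])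
    qed
    then interpret adapted_filtrations n \<phi> "\<lambda>i. fst (b l i)" "\<lambda>i. snd (b l i)" ?U ?W .
    have Q: "slice_module (presented_module P) l = quotients"
      by (simp add: slice_module_def presented_module_def quotients_def ambient_space_def flip: n_def)
    have MQ: "pm_iso (slice_module M l) quotients"
      using pm_iso_slice[OF iso l'] by (simp add: Q)
    have Ml: "persistence_module (slice_module M l)"
      by (rule persistence_module_slice[OF M l'])
    have "vectorspace class_ring (pspace quotients x)" for x
      using MQ unfolding pm_iso_def linear_map_def by blast
    then have "pm_iso quotients
      (pm_direct_sum {..<length bs} (\<lambda>k. interval_module (fst (b l (bs ! k)), snd (b l (bs ! k)))))"
      by (rule quotients_iso_intervals) (use pm_iso_pmap_closed[OF Ml MQ] bs[OF l] in auto)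
    also have "pm_direct_sum {..<length bs} (\<lambda>k. interval_module (fst (b l (bs ! k)), snd (b l (bs ! k)))) =
      pm_direct_sum {..<length bs} (\<lambda>k. interval_module (map (b l) bs ! k))"
      by (rule pm_direct_sum_cong) simp
    finally have "pm_iso (slice_module M l)
      (pm_direct_sum {..<length bs} (\<lambda>k. interval_module (map (b l) bs ! k)))"
      by (rule pm_iso_trans[OF MQ])
    moreover have "ereal c < d" if cd: "(c, d) \<in># mset (map (b l) bs)" for c d
    proof -
      obtain i where "i \<in> set bs" "(c, d) = b l i" using cd by auto
      then show ?thesis using bs(2)[OF l] by (metis (mono_tags, lifting) fst_conv mem_Collect_eq snd_conv)
    qed
    then have "\<forall>(c, d)\<in>#mset (map (b l) bs). ereal c < d" by blast
    ultimately have "is_persistence_diagram (slice_module M l) (mset (map (b l) bs))"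
      unfolding is_persistence_diagram_def by (intro conjI exI[of _ "map (b l) bs"] refl) simp_all
    also have "mset (map (b l) bs) = image_mset (bar (slice_time l)) A"
      by (simp add: A_def b_def[abs_def] multiset.map_comp o_def)
    finally show ?thesis by (rule persistence_diagram_eqI[OF Ml])
  qed
  moreover have "\<forall>l\<in>F. \<forall>u\<in>#A. ereal (fst (bar (slice_time l) u)) < snd (bar (slice_time l) u)"
    using bs(2) by (auto simp: A_def b_def)
  ultimately show ?thesis by blast
qed

section \<open>Transfer of bottleneck distances\<close>

lemma matching_cost_le_iff:
  "matching_cost D1 D2 S \<le> x \<longleftrightarrow> 0 \<le> x \<and> (\<forall>u w. (u, w) \<in># S \<longrightarrow> pair_cost u w \<le> x) \<and>
     (\<forall>a b. (a, b) \<in># (D1 - image_mset fst S) + (D2 - image_mset snd S) \<longrightarrow> (b - ereal a) / 2 \<le> x)"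
proof -
  have "{pair_cost u v | u v. (u, v) \<in># S} = (\<lambda>(u, v). pair_cost u v) ` set_mset S"
    "{(b - ereal a) / 2 | a b. (a, b) \<in># (D1 - image_mset fst S) + (D2 - image_mset snd S)} =
      (\<lambda>(a, b). (b - ereal a) / 2) ` set_mset ((D1 - image_mset fst S) + (D2 - image_mset snd S))"
    by force+
  then show ?thesis
    unfolding matching_cost_def by (subst Max_le_iff) auto
qed

text \<open>
  A finite set that contains the cost of every matching. It shows that the infimum over all matchings is
  attained.
\<close>

definition possible_costs :: "(real \<times> ereal) multiset \<Rightarrow> (real \<times> ereal) multiset \<Rightarrow> ereal set" where
  "possible_costs D1 D2 = insert 0 ((\<lambda>(u, v). pair_cost u v) ` (set_mset D1 \<times> set_mset D2) \<union>
     (\<lambda>(a, b). (b - ereal a) / 2) ` set_mset (D1 + D2))"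

lemma matchings_memD:
  assumes "S \<in> matchings D1 D2" "(u, w) \<in># S"
  shows "u \<in># D1" "w \<in># D2"
proof -
  have "u \<in># image_mset fst S" "w \<in># image_mset snd S"
    using assms(2) by force+
  then show "u \<in># D1" "w \<in># D2"
    using assms(1) unfolding matchings_def by (blast dest: mset_subset_eqD)+
qed

lemma matching_cost_possible:
  assumes "S \<in> matchings D1 D2"
  shows "matching_cost D1 D2 S \<in> possible_costs D1 D2"
proof -
  let ?X = "insert 0 ({pair_cost u v | u v. (u, v) \<in># S} \<union>
    {(b - ereal a) / 2 | a b. (a, b) \<in># (D1 - image_mset fst S) + (D2 - image_mset snd S)})"
  have "?X \<subseteq> possible_costs D1 D2"
    using matchings_memD[OF assms] by (auto simp: possible_costs_def dest: in_diffD)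
  moreover from this have "finite ?X"
    by (rule finite_subset) (simp add: possible_costs_def)
  then have "Max ?X \<in> ?X" by (intro Max_in) auto
  ultimately show ?thesis unfolding matching_cost_def by blast
qed

lemma diagram_bottleneck_attained:
  "\<exists>S\<in>matchings D1 D2. diagram_bottleneck D1 D2 = matching_cost D1 D2 S"
proof -
  let ?C = "matching_cost D1 D2 ` matchings D1 D2"
  have "{#} \<in> matchings D1 D2" by (simp add: matchings_def)
  then have "?C \<noteq> {}" by blast
  moreover have "finite (possible_costs D1 D2)" by (simp add: possible_costs_def)
  then have "finite ?C"
    by (rule finite_subset[rotated]) (use matching_cost_possible in blast)
  ultimately have "Inf ?C \<in> ?C" using Min_in[of ?C] by (simp add: Min_Inf)
  then show ?thesis unfolding diagram_bottleneck_def by auto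
qed

lemma pair_cost_bar:
  "pair_cost (bar \<tau> (p, q)) (bar \<tau> (p', q')) = max (ereal \<bar>\<tau> p - \<tau> p'\<bar>)
     (case (q, q') of (None, None) \<Rightarrow> 0 | (Some q, Some q') \<Rightarrow> ereal \<bar>\<tau> q - \<tau> q'\<bar> | _ \<Rightarrow> \<infinity>)"
  by (auto simp: pair_cost_def bar_def split: option.split)

text \<open>
  The cost of a matching is infinite or a weighted difference of two times. Matched bars come from different presentations, where the weight is \<open>1\<close>, and cost a difference of two times. An
  unmatched bar costs half its length, which is a difference of two times of the same presentation, where the
  weight is \<open>1/2\<close>. The cost \<open>0\<close> is that of a grade paired with itself.
\<close>

lemma diagram_bottleneck_value:
  fixes G1 G2 :: "(real \<times> real) multiset"
  assumes A: "set_mset A \<subseteq> grade_pairs G1" and B: "set_mset B \<subseteq> grade_pairs G2"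
    and bars: "\<And>u. u \<in># A + B \<Longrightarrow> ereal (fst (bar \<tau> u)) < snd (bar \<tau> u)"
    and nonempty: "Sum_Type.Plus (set_mset G1) (set_mset G2) \<noteq> {}"
    and fin: "diagram_bottleneck (image_mset (bar \<tau>) A) (image_mset (bar \<tau>) B) < \<infinity>"
  shows "\<exists>p\<in>Sum_Type.Plus (set_mset G1) (set_mset G2). \<exists>q\<in>Sum_Type.Plus (set_mset G1) (set_mset G2).
    diagram_bottleneck (image_mset (bar \<tau>) A) (image_mset (bar \<tau>) B) =
      ereal (cost_weight p q * \<bar>\<tau> (untag p) - \<tau> (untag q)\<bar>)"
proof -
  let ?D1 = "image_mset (bar \<tau>) A" and ?D2 = "image_mset (bar \<tau>) B"
  let ?G = "Sum_Type.Plus (set_mset G1) (set_mset G2)"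
  define x where "x = diagram_bottleneck ?D1 ?D2"
  define Cands where "Cands = {ereal (cost_weight p q * \<bar>\<tau> (untag p) - \<tau> (untag q)\<bar>) | p q. p \<in> ?G \<and> q \<in> ?G}"
  have Cands: "ereal (cost_weight p q * \<bar>\<tau> (untag p) - \<tau> (untag q)\<bar>) \<in> Cands"
    if "p \<in> ?G" "q \<in> ?G" for p q
    using that unfolding Cands_def by blast
  have pairs: "ereal \<bar>\<tau> p - \<tau> q\<bar> \<in> Cands" if "p \<in># G1" "q \<in># G2" for p q
    using Cands[of "Inl p" "Inr q"] that
    by (simp add: cost_weight_def same_origin_def untag_def InlI InrI)
  have halves: "ereal (\<bar>\<tau> p - \<tau> q\<bar> / 2) \<in> Cands" if "p \<in># G1 \<and> q \<in># G1 \<or> p \<in># G2 \<and> q \<in># G2" for p q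
    using Cands[of "Inl p" "Inl q"] Cands[of "Inr p" "Inr q"] that
    by (auto simp: cost_weight_def same_origin_def untag_def InlI InrI)
  obtain g where "g \<in> ?G" using nonempty by blast
  then have zero: "0 \<in> Cands"
    using Cands[of g g] by (simp add: zero_ereal_def)
  have half: "(snd (bar \<tau> u) - ereal (fst (bar \<tau> u))) / 2 \<in> insert \<infinity> Cands" if u: "u \<in># A + B" for u
  proof -
    obtain p q where pq: "u = (p, q)" by (cases u)
    show ?thesis
    proof (cases q)
      case (Some q')
      then have "\<tau> p < \<tau> q'" using bars[OF u] by (simp add: pq bar_def)
      moreover have "p \<in># G1 \<and> q' \<in># G1 \<or> p \<in># G2 \<and> q' \<in># G2"
        using u A B Some by (auto simp: pq grade_pairs_def)
      ultimately show ?thesis using halves[of p q'] Some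
        by (simp add: pq bar_def abs_if)
    qed (simp add: pq bar_def)
  qed
  have pair: "pair_cost (bar \<tau> u) (bar \<tau> w) \<in> insert \<infinity> Cands" if uw: "u \<in># A" "w \<in># B" for u w
  proof -
    obtain p q p' q' where pq: "u = (p, q)" "w = (p', q')" by (cases u, cases w)
    have "p \<in># G1" "p' \<in># G2" "\<And>z. q = Some z \<Longrightarrow> z \<in># G1" "\<And>z. q' = Some z \<Longrightarrow> z \<in># G2"
      using uw A B by (auto simp: pq grade_pairs_def)
    then show ?thesis
      using pairs zero by (auto simp: pq pair_cost_bar max_def split: option.split)
  qed
  obtain S where "S \<in> matchings ?D1 ?D2" "x = matching_cost ?D1 ?D2 S"
    using diagram_bottleneck_attained unfolding x_def by blast
  then have "x \<in> possible_costs ?D1 ?D2" by (simp add: matching_cost_possible)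
  then consider "x = 0"
    | z where "z \<in> set_mset ?D1 \<times> set_mset ?D2" "x = (case z of (u, v) \<Rightarrow> pair_cost u v)"
    | z where "z \<in># ?D1 + ?D2" "x = (case z of (a, b) \<Rightarrow> (b - ereal a) / 2)"
    unfolding possible_costs_def by blast
  then have "x \<in> insert \<infinity> Cands"
  proof cases
    case 1
    then show ?thesis using zero by simp
  next
    case (2 z)
    then obtain u w where "u \<in># A" "w \<in># B" "z = (bar \<tau> u, bar \<tau> w)" by auto
    then show ?thesis using pair[of u w] 2 by simp
  next
    case (3 z)
    then have "z \<in># image_mset (bar \<tau>) (A + B)" by simp
    then obtain u where "u \<in># A + B" "z = bar \<tau> u" unfolding set_image_mset by blast
    then show ?thesis using half[of u] 3 by (simp add: case_prod_unfold)
  qed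
  then have "x \<in> Cands" using fin by (auto simp: x_def)
  then show ?thesis unfolding Cands_def x_def by blast
qed

text \<open>
  Different grades may have the same time, so a bar does not determine the pair of grades it comes from; but
  if coincidences of times persist, it determines the bar that this pair yields for the times \<open>\<tau>'\<close>.
\<close>

lemma bar_factor:
  assumes A: "set_mset A \<subseteq> grade_pairs G"
    and eq: "\<And>p q. p \<in># G \<Longrightarrow> q \<in># G \<Longrightarrow> \<tau> p = \<tau> q \<Longrightarrow> \<tau>' p = \<tau>' q"
  shows "\<exists>\<phi>. \<forall>u\<in>#A. \<phi> (bar \<tau> u) = bar \<tau>' u"
proof -
  have "bar \<tau>' u = bar \<tau>' w" if "u \<in># A" "w \<in># A" "bar \<tau> u = bar \<tau> w" for u w
  proof -
    obtain p q p' q' where pq: "u = (p, q)" "w = (p', q')" by (cases u, cases w)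
    have "p \<in># G" "p' \<in># G" "\<And>z. q = Some z \<Longrightarrow> z \<in># G" "\<And>z. q' = Some z \<Longrightarrow> z \<in># G"
      using that A by (auto simp: pq grade_pairs_def)
    then show ?thesis
      using that(3) eq[of p p'] eq[of "the q" "the q'"]
      by (cases q; cases q') (simp_all add: pq bar_def)
  qed
  then have "bar \<tau>' (inv_into (set_mset A) (bar \<tau>) (bar \<tau> u)) = bar \<tau>' u" if "u \<in># A" for u
    using that by (meson f_inv_into_f image_eqI inv_into_into)
  then show ?thesis by (intro exI[of _ "\<lambda>z. bar \<tau>' (inv_into (set_mset A) (bar \<tau>) z)"]) simp
qed

text \<open>
  Applying the maps of \<open>bar_factor\<close> to an optimal matching for \<open>\<tau>\<close> gives a matching for \<open>\<tau>'\<close>. Its costs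
  are weighted differences of times of the same grades as before, so they are at most \<open>v'\<close> if they were at most \<open>v\<close>.
\<close>

lemma diagram_bottleneck_transfer:
  fixes G1 G2 :: "(real \<times> real) multiset"
  assumes A: "set_mset A \<subseteq> grade_pairs G1" and B: "set_mset B \<subseteq> grade_pairs G2"
    and bars: "\<And>u. u \<in># A + B \<Longrightarrow> ereal (fst (bar \<tau> u)) < snd (bar \<tau> u)"
      "\<And>u. u \<in># A + B \<Longrightarrow> ereal (fst (bar \<tau>' u)) < snd (bar \<tau>' u)"
    and eq: "\<And>p q. p \<in># G1 \<and> q \<in># G1 \<or> p \<in># G2 \<and> q \<in># G2 \<Longrightarrow> \<tau> p = \<tau> q \<Longrightarrow> \<tau>' p = \<tau>' q"
    and le: "\<And>p q. p \<in> Sum_Type.Plus (set_mset G1) (set_mset G2) \<Longrightarrow>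
      q \<in> Sum_Type.Plus (set_mset G1) (set_mset G2) \<Longrightarrow>
      cost_weight p q * \<bar>\<tau> (untag p) - \<tau> (untag q)\<bar> \<le> v \<Longrightarrow>
      cost_weight p q * \<bar>\<tau>' (untag p) - \<tau>' (untag q)\<bar> \<le> v'"
    and "0 \<le> v'"
    and dB: "diagram_bottleneck (image_mset (bar \<tau>) A) (image_mset (bar \<tau>) B) \<le> ereal v"
  shows "diagram_bottleneck (image_mset (bar \<tau>') A) (image_mset (bar \<tau>') B) \<le> ereal v'"
proof -
  let ?D1 = "image_mset (bar \<tau>) A" and ?D2 = "image_mset (bar \<tau>) B"
  let ?E1 = "image_mset (bar \<tau>') A" and ?E2 = "image_mset (bar \<tau>') B"
  obtain S where S: "S \<in> matchings ?D1 ?D2" "matching_cost ?D1 ?D2 S \<le> ereal v"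
    using diagram_bottleneck_attained[of ?D1 ?D2] dB by auto
  have "\<exists>\<phi>. \<forall>u\<in>#A. \<phi> (bar \<tau> u) = bar \<tau>' u"
    by (rule bar_factor[OF A]) (rule eq, simp_all)
  then obtain \<phi>1 where \<phi>1: "\<And>u. u \<in># A \<Longrightarrow> \<phi>1 (bar \<tau> u) = bar \<tau>' u" by metis
  have "\<exists>\<phi>. \<forall>u\<in>#B. \<phi> (bar \<tau> u) = bar \<tau>' u"
    by (rule bar_factor[OF B]) (rule eq, simp_all)
  then obtain \<phi>2 where \<phi>2: "\<And>u. u \<in># B \<Longrightarrow> \<phi>2 (bar \<tau> u) = bar \<tau>' u" by metis
  note \<phi> = \<phi>1 \<phi>2
  have E: "?E1 = image_mset \<phi>1 ?D1" "?E2 = image_mset \<phi>2 ?D2"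
    using \<phi> by (auto simp: multiset.map_comp intro!: multiset.map_cong)
  define S' where "S' = image_mset (map_prod \<phi>1 \<phi>2) S"
  have S'_proj: "image_mset fst S' = image_mset \<phi>1 (image_mset fst S)"
    "image_mset snd S' = image_mset \<phi>2 (image_mset snd S)"
    by (simp_all add: S'_def multiset.map_comp o_def)
  have sub: "image_mset fst S \<subseteq># ?D1" "image_mset snd S \<subseteq># ?D2"
    using S(1) by (simp_all add: matchings_def)
  have S': "S' \<in> matchings ?E1 ?E2"
    using sub unfolding matchings_def mem_Collect_eq S'_proj E by (intro conjI image_mset_subseteq_mono)
  have half: "(snd (bar \<tau>' u) - ereal (fst (bar \<tau>' u))) / 2 \<le> ereal v'"
    if u: "u \<in># A + B" and *: "(snd (bar \<tau> u) - ereal (fst (bar \<tau> u))) / 2 \<le> ereal v" for u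
  proof -
    obtain p q where pq: "u = (p, q)" by (cases u)
    obtain q' where q': "q = Some q'"
      using * by (cases q) (auto simp: pq bar_def)
    have "\<tau> p < \<tau> q'" "\<tau>' p < \<tau>' q'"
      using bars(1)[OF u] bars(2)[OF u] by (simp_all add: pq bar_def q')
    moreover have "p \<in># G1 \<and> q' \<in># G1 \<or> p \<in># G2 \<and> q' \<in># G2"
      using u A B q' by (auto simp: pq grade_pairs_def)
    ultimately show ?thesis
      using * le[of "Inl p" "Inl q'"] le[of "Inr p" "Inr q'"]
      by (auto simp: pq q' bar_def cost_weight_def same_origin_def untag_def InlI InrI)
  qed
  have "matching_cost ?E1 ?E2 S' \<le> ereal v'"
    unfolding matching_cost_le_iff
  proof (intro conjI allI impI)
    fix u' w' assume "(u', w') \<in># S'"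
    then obtain u w where uw: "(u, w) \<in># S" "u' = \<phi>1 u" "w' = \<phi>2 w"
      by (auto simp: S'_def)
    obtain a b where ab: "a \<in># A" "u = bar \<tau> a" "b \<in># B" "w = bar \<tau> b"
      using matchings_memD[OF S(1) uw(1)] by auto
    obtain p q p' q' where pq: "a = (p, q)" "b = (p', q')" by (cases a, cases b)
    have mem: "p \<in># G1" "p' \<in># G2" "\<And>z. q = Some z \<Longrightarrow> z \<in># G1" "\<And>z. q' = Some z \<Longrightarrow> z \<in># G2"
      using ab A B by (auto simp: pq grade_pairs_def)
    have mixed: "\<bar>\<tau>' z - \<tau>' z'\<bar> \<le> v'" if "z \<in># G1" "z' \<in># G2" "\<bar>\<tau> z - \<tau> z'\<bar> \<le> v" for z z'
      using le[of "Inl z" "Inr z'"] that by (simp add: cost_weight_def same_origin_def untag_def InlI InrI)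
    have "pair_cost u w \<le> ereal v"
      using S(2) uw(1) unfolding matching_cost_le_iff by blast
    then have "pair_cost (bar \<tau>' a) (bar \<tau>' b) \<le> ereal v'"
      using mem mixed \<open>0 \<le> v'\<close> unfolding ab(2,4) pq pair_cost_bar
      by (auto split: option.splits)
    then show "pair_cost u' w' \<le> ereal v'"
      using ab \<phi> by (simp add: uw)
  next
    fix a' b' assume *: "(a', b') \<in># (?E1 - image_mset fst S') + (?E2 - image_mset snd S')"
    have diff: "?E1 - image_mset fst S' = image_mset \<phi>1 (?D1 - image_mset fst S)"
      "?E2 - image_mset snd S' = image_mset \<phi>2 (?D2 - image_mset snd S)"
      unfolding S'_proj E using sub by (simp_all add: image_mset_Diff)
    have unmatched: "(snd z - ereal (fst z)) / 2 \<le> ereal v"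
      if "z \<in># (?D1 - image_mset fst S) + (?D2 - image_mset snd S)" for z
      using S(2) that unfolding matching_cost_le_iff by (cases z) (metis fst_conv snd_conv)
    from * consider z where "z \<in># ?D1 - image_mset fst S" "(a', b') = \<phi>1 z"
      | z where "z \<in># ?D2 - image_mset snd S" "(a', b') = \<phi>2 z"
      unfolding diff by auto
    then obtain u where "u \<in># A + B" "(a', b') = bar \<tau>' u" "(snd (bar \<tau> u) - ereal (fst (bar \<tau> u))) / 2 \<le> ereal v"
    proof cases
      case (1 z)
      have "z \<in># ?D1" using 1(1) by (rule in_diffD)
      then obtain u where "u \<in># A" "z = bar \<tau> u" by auto
      then show ?thesis using that[of u] 1 \<phi> unmatched[of z] by simp
    next
      case (2 z)
      have "z \<in># ?D2" using 2(1) by (rule in_diffD)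
      then obtain u where "u \<in># B" "z = bar \<tau> u" by auto
      then show ?thesis using that[of u] 2 \<phi> unmatched[of z] by simp
    qed
    then show "(b' - ereal a') / 2 \<le> ereal v'"
      using half[of u] by (metis fst_conv snd_conv)
  qed (use \<open>0 \<le> v'\<close> in simp)
  then show ?thesis
    unfolding diagram_bottleneck_def using INF_lower2[OF S'] by blast
qed

section \<open>Signs of affine functions on faces\<close>

text \<open>
  The time of a grade up to a positive factor that depends on the slice only. In contrast to the time
  itself, it is an affine function of the slice on either side of the dual line of the grade.
\<close>

definition slice_height :: "real \<times> real \<Rightarrow> real \<times> real \<Rightarrow> real" where
  "slice_height = (\<lambda>(s, t) p. max (s * fst p) (snd p - t))"

lemma slice_time_eq_height:
  assumes "l \<in> slice_params"
  shows "\<exists>K>0. \<forall>p. slice_time l p = K * slice_height l p"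
proof -
  obtain s t where l: "l = (s, t)" "s > 0"
    using assms by (auto simp: slice_params_def)
  have "1 + s\<^sup>2 > 0" by (simp add: add_pos_nonneg)
  then have "sqrt (1 + s\<^sup>2) / s > 0" using l(2) by simp
  moreover have "slice_time l p = sqrt (1 + s\<^sup>2) / s * slice_height l p" for p
  proof -
    have "max (fst p) ((snd p - t) / s) = max (s * fst p / s) ((snd p - t) / s)"
      using l(2) by simp
    also have "\<dots> = max (s * fst p) (snd p - t) / s"
      using l(2) by (simp add: max_divide_distrib_right)
    finally show ?thesis by (simp add: l(1) slice_time_def slice_height_def)
  qed
  ultimately show ?thesis by blast
qed

definition affine_fun :: "(real \<times> real \<Rightarrow> real) \<Rightarrow> bool" where
  "affine_fun h \<longleftrightarrow> (\<exists>a b c. \<forall>s t. h (s, t) = a * s + b * t + c)"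

lemma affine_funI: "(\<And>s t. h (s, t) = a * s + b * t + c) \<Longrightarrow> affine_fun h"
  unfolding affine_fun_def by blast

lemma affine_fun_comb:
  assumes "affine_fun g" "affine_fun h"
  shows "affine_fun (\<lambda>l. u * g l + e * (v * h l))"
proof -
  obtain a b c where g: "\<And>s t. g (s, t) = a * s + b * t + c"
    using assms(1) unfolding affine_fun_def by blast
  obtain a' b' c' where h: "\<And>s t. h (s, t) = a' * s + b' * t + c'"
    using assms(2) unfolding affine_fun_def by blast
  show ?thesis
    by (rule affine_funI[of _ "u * a + e * v * a'" "u * b + e * v * b'" "u * c + e * v * c'"])
      (simp add: g h algebra_simps)
qed

lemma affine_fun_face_fun: "affine_fun (face_fun f p q)"
proof -
  consider "\<forall>l\<in>f. above_slice p l \<and> above_slice q l"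
    | "\<not> (\<forall>l\<in>f. above_slice p l \<and> above_slice q l)" "\<forall>l\<in>f. below_slice p l \<and> below_slice q l"
    | "\<not> (\<forall>l\<in>f. above_slice p l \<and> above_slice q l)" "\<not> (\<forall>l\<in>f. below_slice p l \<and> below_slice q l)"
      "\<forall>l\<in>f. above_slice p l \<and> below_slice q l"
    | "\<not> (\<forall>l\<in>f. above_slice p l \<and> above_slice q l)" "\<not> (\<forall>l\<in>f. below_slice p l \<and> below_slice q l)"
      "\<not> (\<forall>l\<in>f. above_slice p l \<and> below_slice q l)"
    by blast
  then show ?thesis
  proof cases
    case 1
    have "face_fun f p q = (\<lambda>(s, t). snd p - snd q)"
      unfolding face_fun_def by (simp only: if_P[OF 1])
    then show ?thesis by (intro affine_funI[of _ 0 0 "snd p - snd q"]) simp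
  next
    case 2
    have "face_fun f p q = (\<lambda>(s, t). s * (fst p - fst q))"
      unfolding face_fun_def by (simp only: if_not_P[OF 2(1)] if_P[OF 2(2)])
    then show ?thesis by (intro affine_funI[of _ "fst p - fst q" 0 0]) simp
  next
    case 3
    have "face_fun f p q = (\<lambda>(s, t). snd p - t - s * fst q)"
      unfolding face_fun_def by (simp only: if_not_P[OF 3(1)] if_not_P[OF 3(2)] if_P[OF 3(3)])
    then show ?thesis by (intro affine_funI[of _ "- fst q" "-1" "snd p"]) simp
  next
    case 4
    have "face_fun f p q = (\<lambda>(s, t). snd q - t - s * fst p)"
      unfolding face_fun_def by (simp only: if_not_P[OF 4(1)] if_not_P[OF 4(2)] if_not_P[OF 4(3)])
    then show ?thesis by (intro affine_funI[of _ "- fst p" "-1" "snd q"]) simp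
  qed
qed

lemma continuous_affine_fun: "affine_fun h \<Longrightarrow> continuous_on S h"
proof -
  assume "affine_fun h"
  then obtain a b c where h: "\<And>s t. h (s, t) = a * s + b * t + c"
    unfolding affine_fun_def by blast
  have "h = (\<lambda>l. a * fst l + b * snd l + c)" by (auto simp: h)
  then show ?thesis by (auto intro!: continuous_intros)
qed

lemma connected_nonzero_sign:
  fixes h :: "'a::topological_space \<Rightarrow> real"
  assumes "connected S" "continuous_on S h" "\<And>l. l \<in> S \<Longrightarrow> h l \<noteq> 0" "l \<in> S" "l' \<in> S"
  shows "sgn (h l) = sgn (h l')"
proof (rule ccontr)
  assume "sgn (h l) \<noteq> sgn (h l')"
  then have "h l < 0 \<and> 0 < h l' \<or> h l' < 0 \<and> 0 < h l"
    using assms(3)[OF assms(4)] assms(3)[OF assms(5)] by (auto simp: sgn_if split: if_splits)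
  moreover have "connected (h ` S)" using assms(1,2) by (rule connected_continuous_image[rotated])
  ultimately have "0 \<in> h ` S"
    using connectedD_interval[of "h ` S" "h l" "h l'" 0] connectedD_interval[of "h ` S" "h l'" "h l" 0]
      assms(4,5) by auto
  then show False using assms(3) by force
qed

lemma zero_set_is_line:
  assumes "affine_fun h" "h l \<noteq> 0" "h l' = 0"
  shows "is_line {l. h l = 0}"
proof -
  obtain a b c where h: "\<And>s t. h (s, t) = a * s + b * t + c"
    using assms(1) unfolding affine_fun_def by blast
  have eq: "{l. h l = 0} = {l. (a, b) \<bullet> l = - c}"
    by (auto simp: h inner_prod_def)
  have "(a, b) \<noteq> (0, 0)"
    using assms(2,3) h by (cases l; cases l') auto
  then have "aff_dim {l. (a, b) \<bullet> l = - c} = int (DIM(real \<times> real) - 1)"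
    by (intro aff_dim_hyperplane) (simp add: zero_prod_def)
  then show ?thesis
    unfolding is_line_def eq using affine_hyperplane by auto
qed

text \<open>
  If \<open>h\<close> vanishes somewhere on \<open>S\<close>, its zero set cannot be a line, so \<open>h\<close> vanishes everywhere. Otherwise its
  sign is constant by connectedness.
\<close>

lemma affine_sign_constant:
  assumes "connected S" "affine_fun h"
    and "is_line {l. h l = 0} \<Longrightarrow> {l. h l = 0} \<inter> S = {}"
    and "l \<in> S" "l' \<in> S"
  shows "sgn (h l) = sgn (h l')"
proof (cases "\<exists>z\<in>S. h z = 0")
  case True
  then have "h z = 0" for z
    using zero_set_is_line[OF assms(2)] assms(3) by blast
  then show ?thesis by simp
next
  case False
  then show ?thesis
    using connected_nonzero_sign[OF assms(1) continuous_affine_fun[OF assms(2)] _ assms(4,5)] by blast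
qed

lemma base_face_side:
  assumes f0: "f0 \<in> faces (base_lines PM PN)" and p: "p \<in> set_mset (gr PM) \<union> set_mset (gr PN)"
  shows "(\<forall>l\<in>f0. above_slice p l) \<or> (\<forall>l\<in>f0. below_slice p l)"
proof -
  define h where "h = (\<lambda>(s, t). snd p - (s * fst p + t))"
  have h_side: "above_slice p l \<longleftrightarrow> 0 < h l" "below_slice p l \<longleftrightarrow> h l < 0" for l
    by (auto simp: above_slice_def below_slice_def h_def split: prod.split)
  have "affine_fun h"
    by (rule affine_funI[of _ "- fst p" "-1" "snd p"]) (simp add: h_def)
  moreover have "h l \<noteq> 0" if "l \<in> f0" for l
  proof -
    have "f0 \<subseteq> slice_params - \<Union> (base_lines PM PN)"
      using f0 unfolding faces_def by (rule in_components_subset)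
    then have "l \<notin> dual_line p" using that p unfolding base_lines_def by blast
    then show ?thesis by (cases l) (auto simp: h_def dual_line_def)
  qed
  moreover have "connected f0" using f0 unfolding faces_def by (rule in_components_connected)
  ultimately have sgn: "sgn (h l) = sgn (h l')" and nz: "h l \<noteq> 0" if "l \<in> f0" "l' \<in> f0" for l l'
    using that connected_nonzero_sign[of f0 h] continuous_affine_fun by blast+
  show ?thesis
  proof (cases "\<exists>l\<in>f0. 0 < h l")
    case True
    then obtain l where l: "l \<in> f0" "0 < h l" by blast
    have "0 < h l'" if "l' \<in> f0" for l'
      using sgn[OF l(1) that] l(2) by (simp add: sgn_if split: if_splits)
    then show ?thesis by (simp add: h_side)
  next
    case False
    then show ?thesis using nz unfolding h_side by (meson linorder_neqE_linordered_idom)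
  qed
qed

text \<open>
  The four types are the four ways of evaluating the two maxima in the heights; in type IIIb the
  roles of \<open>p\<close> and \<open>q\<close> are exchanged, which accounts for the sign.
\<close>

lemma face_fun_eq_height_diff:
  assumes f0: "f0 \<in> faces (base_lines PM PN)"
    and p: "p \<in> set_mset (gr PM) \<union> set_mset (gr PN)" and q: "q \<in> set_mset (gr PM) \<union> set_mset (gr PN)"
  shows "\<exists>\<sigma>\<in>{-1, 1}. \<forall>l\<in>f0. face_fun f0 p q l = \<sigma> * (slice_height l p - slice_height l q)"
proof -
  have "f0 \<noteq> {}" using f0 unfolding faces_def by (rule in_components_nonempty)
  then obtain l0 where l0: "l0 \<in> f0" by blast
  have above: "slice_height l v = snd v - snd l" if "above_slice v l" for v l
    using that by (cases l) (auto simp: slice_height_def above_slice_def)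
  have below: "slice_height l v = fst l * fst v" if "below_slice v l" for v l
    using that by (cases l) (auto simp: slice_height_def below_slice_def)
  have excl: "\<not> (above_slice v l0 \<and> below_slice v l0)" for v
    by (cases l0) (auto simp: above_slice_def below_slice_def)
  consider (I) "\<forall>l\<in>f0. above_slice p l \<and> above_slice q l"
    | (II) "\<forall>l\<in>f0. below_slice p l \<and> below_slice q l"
    | (IIIa) "\<forall>l\<in>f0. above_slice p l \<and> below_slice q l"
    | (IIIb) "\<forall>l\<in>f0. below_slice p l \<and> above_slice q l"
    using base_face_side[OF f0 p] base_face_side[OF f0 q] by blast
  then show ?thesis
  proof cases
    case I
    have "face_fun f0 p q = (\<lambda>(s, t). snd p - snd q)"
      unfolding face_fun_def by (simp only: if_P[OF I])
    then show ?thesis using I by (intro bexI[of _ 1]) (auto simp: above)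
  next
    case II
    then have n: "\<not> (\<forall>l\<in>f0. above_slice p l \<and> above_slice q l)" using l0 excl by blast
    have "face_fun f0 p q = (\<lambda>(s, t). s * (fst p - fst q))"
      unfolding face_fun_def by (simp only: if_not_P[OF n] if_P[OF II])
    then show ?thesis using II by (intro bexI[of _ 1]) (auto simp: below algebra_simps)
  next
    case IIIa
    then have n: "\<not> (\<forall>l\<in>f0. above_slice p l \<and> above_slice q l)" "\<not> (\<forall>l\<in>f0. below_slice p l \<and> below_slice q l)"
      using l0 excl by blast+
    have "face_fun f0 p q = (\<lambda>(s, t). snd p - t - s * fst q)"
      unfolding face_fun_def by (simp only: if_not_P[OF n(1)] if_not_P[OF n(2)] if_P[OF IIIa])
    then show ?thesis using IIIa by (intro bexI[of _ 1]) (auto simp: above below)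
  next
    case IIIb
    then have n: "\<not> (\<forall>l\<in>f0. above_slice p l \<and> above_slice q l)" "\<not> (\<forall>l\<in>f0. below_slice p l \<and> below_slice q l)"
      "\<not> (\<forall>l\<in>f0. above_slice p l \<and> below_slice q l)"
      using l0 excl by blast+
    have "face_fun f0 p q = (\<lambda>(s, t). snd q - t - s * fst p)"
      unfolding face_fun_def by (simp only: if_not_P[OF n(1)] if_not_P[OF n(2)] if_not_P[OF n(3)])
    then show ?thesis using IIIb by (intro bexI[of _ "-1"]) (auto simp: above below)
  qed
qed

section \<open>The bottleneck distance on a face\<close>

lemma untag_grade:
  "p \<in> tagged_grades PM PN \<Longrightarrow> untag p \<in> set_mset (gr PM) \<union> set_mset (gr PN)"
  by (auto simp: tagged_grades_def untag_def)

lemma arrangement_face: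
  assumes "f \<in> faces (arrangement PM PN)"
  shows "f \<subseteq> slice_params" "connected f" "f \<noteq> {}"
    and "\<And>L. L \<in> arrangement PM PN \<Longrightarrow> L \<inter> f = {}"
    and "\<exists>f0\<in>faces (base_lines PM PN). f \<subseteq> f0"
proof -
  have comp: "f \<in> components (slice_params - \<Union> (arrangement PM PN))"
    using assms by (simp add: faces_def)
  then have sub: "f \<subseteq> slice_params - \<Union> (arrangement PM PN)"
    by (rule in_components_subset)
  then show "f \<subseteq> slice_params" "\<And>L. L \<in> arrangement PM PN \<Longrightarrow> L \<inter> f = {}" by blast+
  show con: "connected f" using comp by (rule in_components_connected)
  show ne: "f \<noteq> {}" using comp by (rule in_components_nonempty)
  have "f \<subseteq> slice_params - \<Union> (base_lines PM PN)"
    using sub by (auto simp: arrangement_def)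
  then show "\<exists>f0\<in>faces (base_lines PM PN). f \<subseteq> f0"
    using exists_component_superset[of f "slice_params - \<Union> (base_lines PM PN)"] con ne
    by (auto simp: faces_def)
qed

lemma equation_sign_constant:
  assumes f: "f \<in> faces (arrangement PM PN)"
    and "affine_fun h" "{l. h l = 0} \<in> equation_sets PM PN" "l \<in> f" "l' \<in> f"
  shows "sgn (h l) = sgn (h l')"
proof (rule affine_sign_constant[OF arrangement_face(2)[OF f] assms(2) _ assms(4,5)])
  assume line: "is_line {l. h l = 0}"
  show "{l. h l = 0} \<inter> f = {}"
  proof (cases "{l. h l = 0} \<inter> slice_params = {}")
    case True
    then show ?thesis using arrangement_face(1)[OF f] by blast
  next
    case False
    then have "{l. h l = 0} \<in> arrangement PM PN"
      using line assms(3) by (simp add: arrangement_def)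
    then show ?thesis by (rule arrangement_face(4)[OF f])
  qed
qed

text \<open>
  On the face, the difference of the two times is \<open>\<plusminus>g\<^sub>p\<^sub>q\<close> up to a positive factor depending on the slice, the sign being that
  of the type. The equation \<open>g\<^sub>p\<^sub>q = 0\<close> is one of those required of grades of the same origin.
\<close>

lemma slice_time_order_constant:
  assumes f: "f \<in> faces (arrangement PM PN)"
    and pq: "p \<in> tagged_grades PM PN" "q \<in> tagged_grades PM PN" "same_origin p q"
    and l: "l \<in> f" "l' \<in> f"
    and le: "slice_time l (untag p) \<le> slice_time l (untag q)"
  shows "slice_time l' (untag p) \<le> slice_time l' (untag q)"
proof -
  obtain f0 where f0: "f0 \<in> faces (base_lines PM PN)" "f \<subseteq> f0"
    using arrangement_face(5)[OF f] by blast
  have params: "l \<in> slice_params" "l' \<in> slice_params" using arrangement_face(1)[OF f] l by auto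
  have "{l. face_fun f0 (untag p) (untag q) l = 0} \<in> equation_sets PM PN"
    unfolding equation_sets_def using f0(1) pq by blast
  then have sgn: "sgn (face_fun f0 (untag p) (untag q) l) = sgn (face_fun f0 (untag p) (untag q) l')"
    by (intro equation_sign_constant[OF f affine_fun_face_fun _ l])
  obtain \<sigma> :: real where \<sigma>: "\<sigma> \<in> {-1, 1}"
    "\<And>l. l \<in> f0 \<Longrightarrow> face_fun f0 (untag p) (untag q) l = \<sigma> * (slice_height l (untag p) - slice_height l (untag q))"
    using face_fun_eq_height_diff[OF f0(1) untag_grade[OF pq(1)] untag_grade[OF pq(2)]] by blast
  have "sgn (slice_height l (untag p) - slice_height l (untag q)) =
      sgn (slice_height l' (untag p) - slice_height l' (untag q))"
    using sgn \<sigma>(1) unfolding \<sigma>(2)[OF subsetD[OF f0(2) l(1)]] \<sigma>(2)[OF subsetD[OF f0(2) l(2)]] sgn_mult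
    by auto
  moreover have "slice_time k (untag p) \<le> slice_time k (untag q) \<longleftrightarrow>
      sgn (slice_height k (untag p) - slice_height k (untag q)) \<le> 0" if k: "k \<in> slice_params" for k
  proof -
    obtain K where "K > 0" "\<And>v. slice_time k v = K * slice_height k v"
      using slice_time_eq_height[OF k] by blast
    then show ?thesis by (simp add: sgn_if)
  qed
  ultimately show ?thesis using le params by metis
qed

text \<open>
  For two pairs of grades with weights \<open>c\<close>, \<open>c'\<close> and affine functions \<open>g\<close>, \<open>g'\<close> on the face, comparing \<open>c \<bar>g\<bar>\<close> with
  \<open>c' \<bar>g'\<bar>\<close> amounts to determining the sign of the difference of their squares. This factors into
  \<open>c g - c' g'\<close> and \<open>c g + c' g'\<close>, which is why both signs occur among the equations.
\<close>

lemma cost_order_constant: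
  assumes f: "f \<in> faces (arrangement PM PN)"
    and pq: "p \<in> tagged_grades PM PN" "q \<in> tagged_grades PM PN"
      "p' \<in> tagged_grades PM PN" "q' \<in> tagged_grades PM PN"
    and l: "l \<in> f" "l' \<in> f"
    and le: "cost_weight p q * \<bar>slice_time l (untag p) - slice_time l (untag q)\<bar> \<le>
      cost_weight p' q' * \<bar>slice_time l (untag p') - slice_time l (untag q')\<bar>"
  shows "cost_weight p q * \<bar>slice_time l' (untag p) - slice_time l' (untag q)\<bar> \<le>
      cost_weight p' q' * \<bar>slice_time l' (untag p') - slice_time l' (untag q')\<bar>"
proof -
  obtain f0 where f0: "f0 \<in> faces (base_lines PM PN)" "f \<subseteq> f0"
    using arrangement_face(5)[OF f] by blast
  have params: "l \<in> slice_params" "l' \<in> slice_params" using arrangement_face(1)[OF f] l by auto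
  define g where "g = face_fun f0 (untag p) (untag q)"
  define g' where "g' = face_fun f0 (untag p') (untag q')"
  define h where "h e l = cost_weight p q * g l + e * (cost_weight p' q' * g' l)" for e l
  have sgn: "sgn (h e l) = sgn (h e l')" if e: "e \<in> {-1, 1}" for e
  proof (rule equation_sign_constant[OF f _ _ l])
    show "affine_fun (h e)"
      unfolding h_def[abs_def] g_def g'_def by (intro affine_fun_comb affine_fun_face_fun)
    show "{l. h e l = 0} \<in> equation_sets PM PN"
      unfolding equation_sets_def h_def g_def g'_def using f0(1) pq e by blast
  qed
  have abs_g: "\<bar>face_fun f0 (untag p) (untag q) k\<bar> = \<bar>slice_height k (untag p) - slice_height k (untag q)\<bar>"
    if pq: "p \<in> tagged_grades PM PN" "q \<in> tagged_grades PM PN" and k: "k \<in> f" for k p q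
  proof -
    obtain \<sigma> :: real where "\<sigma> \<in> {-1, 1}"
      "face_fun f0 (untag p) (untag q) k = \<sigma> * (slice_height k (untag p) - slice_height k (untag q))"
      using face_fun_eq_height_diff[OF f0(1) untag_grade[OF pq(1)] untag_grade[OF pq(2)]]
        subsetD[OF f0(2) k] by blast
    then show ?thesis by (auto simp: abs_mult)
  qed
  have weight: "0 \<le> cost_weight p q" for p q by (simp add: cost_weight_def)
  have cost_iff: "cost_weight p q * \<bar>slice_time k (untag p) - slice_time k (untag q)\<bar> \<le>
      cost_weight p' q' * \<bar>slice_time k (untag p') - slice_time k (untag q')\<bar> \<longleftrightarrow>
      sgn (h (-1) k) * sgn (h 1 k) \<le> 0" if k: "k \<in> f" for k
  proof -
    obtain K where K: "K > 0" "\<And>p. slice_time k p = K * slice_height k p"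
      using slice_time_eq_height[of k] arrangement_face(1)[OF f] k by blast
    have time: "\<bar>slice_time k x - slice_time k y\<bar> = K * \<bar>slice_height k x - slice_height k y\<bar>" for x y
      using K(1) by (simp add: K(2) abs_mult flip: right_diff_distrib)
    have "cost_weight p q * \<bar>slice_time k (untag p) - slice_time k (untag q)\<bar> \<le>
      cost_weight p' q' * \<bar>slice_time k (untag p') - slice_time k (untag q')\<bar> \<longleftrightarrow>
      K * (cost_weight p q * \<bar>g k\<bar>) \<le> K * (cost_weight p' q' * \<bar>g' k\<bar>)"
      unfolding g_def g'_def abs_g[OF pq(1,2) k] abs_g[OF pq(3,4) k] time by (simp add: algebra_simps)
    also have "\<dots> \<longleftrightarrow> \<bar>cost_weight p q * g k\<bar> \<le> \<bar>cost_weight p' q' * g' k\<bar>"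
      using K(1) by (simp add: abs_mult weight)
    also have "\<dots> \<longleftrightarrow> h (-1) k * h 1 k \<le> 0"
      unfolding abs_le_square_iff by (simp add: h_def algebra_simps power2_eq_square)
    also have "\<dots> \<longleftrightarrow> sgn (h (-1) k) * sgn (h 1 k) \<le> 0"
      by (simp flip: sgn_mult)
    finally show ?thesis .
  qed
  show ?thesis
    using le unfolding cost_iff[OF l(1)] cost_iff[OF l(2)] by (simp add: sgn)
qed

theorem theorem9:
  fixes M :: "(real \<times> real, 'k::{field, finite}, 'a) pers_module"
    and N :: "(real \<times> real, 'k, 'b) pers_module"
    and PM PN :: "(real \<times> real, 'k) presentation"
    and f :: "(real \<times> real) set"
  assumes "persistence_module M" and "persistence_module N"
    and "is_presentation_of PM M" and "is_presentation_of PN N"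
    and "f \<in> faces (arrangement PM PN)"
    and "tagged_grades PM PN \<noteq> {}"
    and "\<exists>l\<in>f. bottleneck_dist (slice_module M l) (slice_module N l) < \<infinity>"
  shows "\<exists>p\<in>tagged_grades PM PN. \<exists>q\<in>tagged_grades PM PN. \<forall>l\<in>f.
    bottleneck_dist (slice_module M l) (slice_module N l) =
      ereal (cost_weight p q * push_dist (untag p) (untag q) l)"
proof -
  let ?G = "tagged_grades PM PN"
  note f = assms(5)
  have params: "f \<subseteq> slice_params" by (rule arrangement_face(1)[OF f])
  have time_M: "slice_time l' p \<le> slice_time l' q"
    if "p \<in># gr PM" "q \<in># gr PM" "l \<in> f" "l' \<in> f" "slice_time l p \<le> slice_time l q" for p q l l'
    using slice_time_order_constant[OF f, of "Inl p" "Inl q" l l'] that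
    by (simp add: tagged_grades_def InlI same_origin_def untag_def)
  have time_N: "slice_time l' p \<le> slice_time l' q"
    if "p \<in># gr PN" "q \<in># gr PN" "l \<in> f" "l' \<in> f" "slice_time l p \<le> slice_time l q" for p q l l'
    using slice_time_order_constant[OF f, of "Inr p" "Inr q" l l'] that
    by (simp add: tagged_grades_def InrI same_origin_def untag_def)
  have "\<exists>A. set_mset A \<subseteq> grade_pairs (gr PM) \<and>
    (\<forall>l\<in>f. persistence_diagram (slice_module M l) = image_mset (bar (slice_time l)) A) \<and>
    (\<forall>l\<in>f. \<forall>u\<in>#A. ereal (fst (bar (slice_time l) u)) < snd (bar (slice_time l) u))"
    by (rule slice_diagrams[OF assms(1,3) params]) (rule time_M)
  then obtain A where A: "set_mset A \<subseteq> grade_pairs (gr PM)"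
    and DM: "\<And>l. l \<in> f \<Longrightarrow> persistence_diagram (slice_module M l) = image_mset (bar (slice_time l)) A"
    and barsM: "\<And>l u. l \<in> f \<Longrightarrow> u \<in># A \<Longrightarrow> ereal (fst (bar (slice_time l) u)) < snd (bar (slice_time l) u)"
    by metis
  have "\<exists>B. set_mset B \<subseteq> grade_pairs (gr PN) \<and>
    (\<forall>l\<in>f. persistence_diagram (slice_module N l) = image_mset (bar (slice_time l)) B) \<and>
    (\<forall>l\<in>f. \<forall>u\<in>#B. ereal (fst (bar (slice_time l) u)) < snd (bar (slice_time l) u))"
    by (rule slice_diagrams[OF assms(2,4) params]) (rule time_N)
  then obtain B where B: "set_mset B \<subseteq> grade_pairs (gr PN)"
    and DN: "\<And>l. l \<in> f \<Longrightarrow> persistence_diagram (slice_module N l) = image_mset (bar (slice_time l)) B"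
    and barsN: "\<And>l u. l \<in> f \<Longrightarrow> u \<in># B \<Longrightarrow> ereal (fst (bar (slice_time l) u)) < snd (bar (slice_time l) u)"
    by metis
  have bars: "ereal (fst (bar (slice_time l) u)) < snd (bar (slice_time l) u)"
    if "l \<in> f" "u \<in># A + B" for l u
    using that(2) barsM[OF that(1), of u] barsN[OF that(1), of u] by auto
  define dB where "dB l = bottleneck_dist (slice_module M l) (slice_module N l)" for l
  define c where "c p q l = cost_weight p q * \<bar>slice_time l (untag p) - slice_time l (untag q)\<bar>" for p q l
  have dB: "dB l = diagram_bottleneck (image_mset (bar (slice_time l)) A) (image_mset (bar (slice_time l)) B)"
    if "l \<in> f" for l
    using that by (simp add: dB_def bottleneck_dist_def DM DN)
  have dB_value: "\<exists>p\<in>?G. \<exists>q\<in>?G. dB l = ereal (c p q l)" if "l \<in> f" "dB l < \<infinity>" for l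
    using diagram_bottleneck_value[OF A B bars[OF that(1)]] assms(6) that
    unfolding dB[OF that(1)] c_def tagged_grades_def by blast
  have transfer: "dB l' \<le> ereal (c p q l')"
    if l: "l \<in> f" "l' \<in> f" and pq: "p \<in> ?G" "q \<in> ?G" and le: "dB l \<le> ereal (c p q l)" for l l' p q
    unfolding dB[OF l(2)]
  proof (rule diagram_bottleneck_transfer[OF A B bars[OF l(1)] bars[OF l(2)]])
    show "slice_time l' p = slice_time l' q"
      if "p \<in># gr PM \<and> q \<in># gr PM \<or> p \<in># gr PN \<and> q \<in># gr PN" "slice_time l p = slice_time l q" for p q
      using that time_M[of p q l l'] time_M[of q p l l'] time_N[of p q l l'] time_N[of q p l l'] l by auto
    show "cost_weight p' q' * \<bar>slice_time l' (untag p') - slice_time l' (untag q')\<bar> \<le> c p q l'"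
      if "p' \<in> Sum_Type.Plus (set_mset (gr PM)) (set_mset (gr PN))"
        "q' \<in> Sum_Type.Plus (set_mset (gr PM)) (set_mset (gr PN))"
        "cost_weight p' q' * \<bar>slice_time l (untag p') - slice_time l (untag q')\<bar> \<le> c p q l" for p' q'
      using that pq cost_order_constant[OF f _ _ _ _ l, of p' q' p q]
      by (simp add: c_def tagged_grades_def)
    show "0 \<le> c p q l'" by (simp add: c_def cost_weight_def)
    show "diagram_bottleneck (image_mset (bar (slice_time l)) A) (image_mset (bar (slice_time l)) B)
        \<le> ereal (c p q l)"
      using le by (simp add: dB[OF l(1)])
  qed
  obtain l0 where l0: "l0 \<in> f" "dB l0 < \<infinity>"
    using assms(7) by (auto simp: dB_def)
  obtain p q where pq: "p \<in> ?G" "q \<in> ?G" "dB l0 = ereal (c p q l0)"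
    using dB_value[OF l0] by blast
  have "dB l = ereal (c p q l)" if l: "l \<in> f" for l
  proof (rule antisym)
    show le: "dB l \<le> ereal (c p q l)"
      by (rule transfer[OF l0(1) l pq(1,2)]) (simp add: pq(3))
    then have "dB l < \<infinity>" by (rule order_le_less_trans) simp
    then obtain p' q' where pq': "p' \<in> ?G" "q' \<in> ?G" "dB l = ereal (c p' q' l)"
      using dB_value[OF l] by blast
    \<comment> \<open>Carrying the optimum back from \<open>l\<close> shows that no smaller value is possible at \<open>l\<close>.\<close>
    have "dB l0 \<le> ereal (c p' q' l0)"
      by (rule transfer[OF l l0(1) pq'(1,2)]) (simp add: pq'(3))
    then have "c p q l0 \<le> c p' q' l0" by (simp add: pq(3))
    then have "c p q l \<le> c p' q' l"
      using cost_order_constant[OF f pq(1,2) pq'(1,2) l0(1) l] by (simp add: c_def)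
    then show "ereal (c p q l) \<le> dB l" by (simp add: pq'(3))
  qed
  then have "\<forall>l\<in>f. bottleneck_dist (slice_module M l) (slice_module N l) =
      ereal (cost_weight p q * push_dist (untag p) (untag q) l)"
    using params by (auto simp: dB_def c_def push_dist_eq subset_iff)
  then show ?thesis using pq(1,2) by blast
qed

end
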